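(* Suppose we have a commuting diagram of $!$-graph monomorphisms $L \xleftarrow{i_1} I \xrightarrow{i_2} R$, $m : L \rightarrow G$, $d : I \rightarrow D$, $r : R\rightarrow H$, $g : D \rightarrow G$, $h : D \rightarrow H$ with $m \circ i_1 = g\circ d$ and $r\circ i_2 = h\circ d$, in which both squares are pushouts, where $L \xleftarrow{i_1} I \xrightarrow{i_2} R$ is a $!$-graph rewrite rule and $m$ is not required to be a $!$-graph matching. If $U(G)$ has no isolated vertices, then there is a subgraph $J$ of $D$ such that $G \xleftarrow{g|_J} J \xrightarrow{h|_J} H$ is a $!$-graph rewrite rule.
   Context: Fix a compressed monoidal signature $T=(O,M,\mathrm{dom},\mathrm{cod})$, $\mathrm{dom},\mathrm{cod}: M \rightarrow (O\times\{\mathsf{v},\mathsf{f}\})^*$. The derived compressed typegraph $\mathcal{G}_T$ has vertex set $O\sqcup M$, a self-loop on each $X\in O$, an edge $\mathrm{in}^a_{f,i}$ from $X$ to $f$ for each $f\in M$ and index $i$ with $\mathrm{dom}(f)[i]=(X,a)$, and an edge $\mathrm{out}^a_{f,j}$ from $f$ to $X$ for each index $j$ with $\mathrm{cod}(f)[j]=(X,a)$. $\mathcal{G}_{T!}$ is $\mathcal{G}_T$ plus a vertex $!$, a self-loop on $!$, and an edge from $!$ to each vertex of $\mathcal{G}_T$. For a finite directed multigraph $G$ typed over $\mathcal{G}_{T!}$, vertices typed in $O$, $M$, $!$ are wire-, node-, $!$-vertices; fixed-arity edges are those typed by an $\mathsf{f}$-tagged edge; $U$ deletes $!$-vertices and incident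 edges. A string graph is a $\mathcal{G}_T$-typed graph whose typing restricts at each node-vertex to a bijection on incident fixed-arity edges and whose wire-vertices have at most one incoming and one outgoing edge; inputs (outputs) are wire-vertices with no incoming (outgoing) edge. An open subgraph $O'$ of a string graph $K$ is a string subgraph with no vertex adjacent to a wire-vertex outside $O'$ and no incident fixed-arity edge outside $O'$. $B(b)$ is the full subgraph on successors of a $!$-vertex $b$, $\beta(G)$ the full subgraph on $!$-vertices. A $!$-graph is a $\mathcal{G}_{T!}$-typed graph with $U(G)$ a string graph, $\beta(G)$ posetal (at most one edge between two vertices, edge relation a partial order), $U(B(b))$ open in $U(G)$ for each $!$-vertex $b$, and $B(b')\subseteq B(b)$ whenever $b'\in B(b)$; morphisms are typed graph morphisms, and pushouts are taken in the category of $\mathcal{G}_{T!}$-typed graphs. $\mathrm{In}_!(G)$ (resp. $\mathrm{Out}_!(G)$) is the full subgraph on the $!$-vertices and the inputs (resp. outputs) of $U(G)$; $\mathrm{Bound}_!(G)$ has vertices the $!$-vertices and the inputs and outputs of $U(G)$, and edges those from a $!$-vertex to one of these vertices. A $!$-graph rewrite rule is a span $L\xleftarrow{i_1} I \xrightarrow{i_2} R$ of $!$-graph morphisms such that $U(L),U(R)$ have no isolated wire-vertices and there are isomorphisms $\phi_I:\mathrm{In}_!(L)\cong\mathrm{In}_!(R)$, $\phi_O:\mathrm{Out}_!(L)\cong\mathrm{Out}_!(R)$, $\phi_L:\mathrm{Bound}_!(L)\cong I$, $\phi_R:\mathrm{Bound}_!(R)\cong I$ such that, with $j_1 = \phi_L\circ(\mathrm{In}_!(L)\hookrightarrow\mathrm{Bound}_!(L))$,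 $j_2 = \phi_R\circ(\mathrm{In}_!(R)\hookrightarrow \mathrm{Bound}_!(R))$ and $k_1,k_2$ defined likewise with $\mathrm{Out}_!$, the maps $i_1\circ j_1$, $i_2\circ j_2$, $i_1\circ k_1$, $i_2\circ k_2$ are the respective inclusions into $L$ and $R$, and $j_2\circ\phi_I=j_1$, $k_2\circ\phi_O=k_1$. *)

theory Defs
  imports "Graph_Theory.Digraph_Component" "HOL-Library.FuncSet"
begin

section \<open>Graph maps\<close>

record ('v, 'w, 'e, 'f) gmap =
  vmap :: "'v \<Rightarrow> 'w"
  emap :: "'e \<Rightarrow> 'f"

text \<open>
  Graph maps are given by total functions, of which only the values on the source graph are
  meaningful. Hence equations between maps out of a graph \<open>A\<close> are stated with \<open>gmap_eq A\<close>.
\<close>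

definition gmap_eq ::
  "('v, 'e) pre_digraph \<Rightarrow> ('v, 'w, 'e, 'f) gmap \<Rightarrow> ('v, 'w, 'e, 'f) gmap \<Rightarrow> bool" where
  "gmap_eq A f g \<longleftrightarrow>
     (\<forall>v\<in>verts A. vmap f v = vmap g v) \<and> (\<forall>e\<in>arcs A. emap f e = emap g e)"

definition gmap_id :: "('v, 'v, 'e, 'e) gmap" where
  "gmap_id = \<lparr>vmap = id, emap = id\<rparr>"

definition gmap_comp ::
  "('w, 'x, 'f, 'h) gmap \<Rightarrow> ('v, 'w, 'e, 'f) gmap \<Rightarrow> ('v, 'x, 'e, 'h) gmap"
  (infixl \<open>\<circ>\<^sub>g\<close> 55) where
  "g \<circ>\<^sub>g f = \<lparr>vmap = vmap g \<circ> vmap f, emap = emap g \<circ> emap f\<rparr>"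

definition graph_hom ::
  "('v, 'e) pre_digraph \<Rightarrow> ('v, 'w, 'e, 'f) gmap \<Rightarrow> ('w, 'f) pre_digraph \<Rightarrow> bool" where
  "graph_hom A f B \<longleftrightarrow>
     vmap f \<in> verts A \<rightarrow> verts B \<and> emap f \<in> arcs A \<rightarrow> arcs B \<and>
     (\<forall>e\<in>arcs A. tail B (emap f e) = vmap f (tail A e) \<and> head B (emap f e) = vmap f (head A e))"

section \<open>Compressed monoidal signatures and their typegraphs\<close>

datatype arity = Variable | Fixed

record ('o, 'm) signature =
  sig_objs :: "'o set"
  sig_mors :: "'m set"
  sig_dom :: "'m \<Rightarrow> ('o \<times> arity) list"
  sig_cod :: "'m \<Rightarrow> ('o \<times> arity) list"

definition compressed_signature :: "('o, 'm) signature \<Rightarrow> bool" where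
  "compressed_signature T \<longleftrightarrow>
     (\<forall>f\<in>sig_mors T. sig_dom T f \<in> lists (sig_objs T \<times> UNIV) \<and>
                      sig_cod T f \<in> lists (sig_objs T \<times> UNIV))"

datatype ('o, 'm) tvertex = ObjV 'o | MorV 'm | BangV

datatype ('o, 'm) tedge =
    LoopE 'o
  | InE arity 'm nat
  | OutE arity 'm nat
  | BangLoopE
  | BangE "('o, 'm) tvertex"

fun tedge_tail :: "('o, 'm) signature \<Rightarrow> ('o, 'm) tedge \<Rightarrow> ('o, 'm) tvertex" where
  "tedge_tail T (LoopE X) = ObjV X"
| "tedge_tail T (InE a f i) = ObjV (fst (sig_dom T f ! i))"
| "tedge_tail T (OutE a f j) = MorV f"
| "tedge_tail T BangLoopE = BangV"
| "tedge_tail T (BangE x) = BangV"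

fun tedge_head :: "('o, 'm) signature \<Rightarrow> ('o, 'm) tedge \<Rightarrow> ('o, 'm) tvertex" where
  "tedge_head T (LoopE X) = ObjV X"
| "tedge_head T (InE a f i) = MorV f"
| "tedge_head T (OutE a f j) = ObjV (fst (sig_cod T f ! j))"
| "tedge_head T BangLoopE = BangV"
| "tedge_head T (BangE x) = x"

definition typegraph ::
  "('o, 'm) signature \<Rightarrow> (('o, 'm) tvertex, ('o, 'm) tedge) pre_digraph" where
  "typegraph T =
     \<lparr>verts = ObjV ` sig_objs T \<union> MorV ` sig_mors T,
      arcs = LoopE ` sig_objs T
        \<union> {InE a f i | a f i.
             f \<in> sig_mors T \<and> i < length (sig_dom T f) \<and> snd (sig_dom T f ! i) = a}
        \<union> {OutE a f j | a f j.
             f \<in> sig_mors T \<and> j < length (sig_cod T f) \<and> snd (sig_cod T f ! j) = a},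
      tail = tedge_tail T,
      head = tedge_head T\<rparr>"

definition bang_typegraph ::
  "('o, 'm) signature \<Rightarrow> (('o, 'm) tvertex, ('o, 'm) tedge) pre_digraph" where
  "bang_typegraph T =
     \<lparr>verts = insert BangV (verts (typegraph T)),
      arcs = arcs (typegraph T) \<union> {BangLoopE} \<union> BangE ` verts (typegraph T),
      tail = tedge_tail T,
      head = tedge_head T\<rparr>"

fun fixed_tedge :: "('o, 'm) tedge \<Rightarrow> bool" where
  "fixed_tedge (InE a f i) \<longleftrightarrow> a = Fixed"
| "fixed_tedge (OutE a f j) \<longleftrightarrow> a = Fixed"
| "fixed_tedge _ \<longleftrightarrow> False"

section \<open>Typed graphs\<close>

record ('v, 'e, 'o, 'm) tgraph =
  ugraph :: "('v, 'e) pre_digraph"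
  typing :: "('v, ('o, 'm) tvertex, 'e, ('o, 'm) tedge) gmap"

definition typed_graph ::
  "(('o, 'm) tvertex, ('o, 'm) tedge) pre_digraph \<Rightarrow> ('v, 'e, 'o, 'm) tgraph \<Rightarrow> bool" where
  "typed_graph TG G \<longleftrightarrow> fin_digraph (ugraph G) \<and> graph_hom (ugraph G) (typing G) TG"

definition tmorphism ::
  "('v, 'e, 'o, 'm) tgraph \<Rightarrow> ('v, 'w, 'e, 'f) gmap \<Rightarrow> ('w, 'f, 'o, 'm) tgraph \<Rightarrow> bool" where
  "tmorphism A f B \<longleftrightarrow>
     graph_hom (ugraph A) f (ugraph B) \<and> gmap_eq (ugraph A) (typing B \<circ>\<^sub>g f) (typing A)"

definition tiso ::
  "('v, 'e, 'o, 'm) tgraph \<Rightarrow> ('v, 'w, 'e, 'f) gmap \<Rightarrow> ('w, 'f, 'o, 'm) tgraph \<Rightarrow> bool" where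
  "tiso A f B \<longleftrightarrow>
     tmorphism A f B \<and>
     (\<exists>g. tmorphism B g A \<and> gmap_eq (ugraph A) (g \<circ>\<^sub>g f) gmap_id \<and>
          gmap_eq (ugraph B) (f \<circ>\<^sub>g g) gmap_id)"

definition tsubgraph :: "('v, 'e, 'o, 'm) tgraph \<Rightarrow> ('v, 'e, 'o, 'm) tgraph \<Rightarrow> bool" where
  "tsubgraph H G \<longleftrightarrow> subgraph (ugraph H) (ugraph G) \<and> typing H = typing G"

definition full_subgraph :: "('v, 'e, 'o, 'm) tgraph \<Rightarrow> 'v set \<Rightarrow> ('v, 'e, 'o, 'm) tgraph" where
  "full_subgraph G S = G\<lparr>ugraph := ugraph G \<restriction> S\<rparr>"

definition gmap_restrict ::
  "('v, 'w, 'e, 'f) gmap \<Rightarrow> ('v, 'e, 'o, 'm) tgraph \<Rightarrow> ('v, 'w, 'e, 'f) gmap"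
  (infixl \<open>|\<^sub>g\<close> 60) where
  "f |\<^sub>g A =
     \<lparr>vmap = restrict (vmap f) (verts (ugraph A)), emap = restrict (emap f) (arcs (ugraph A))\<rparr>"

definition wire_verts :: "('v, 'e, 'o, 'm) tgraph \<Rightarrow> 'v set" where
  "wire_verts G = {v \<in> verts (ugraph G). \<exists>X. vmap (typing G) v = ObjV X}"

definition node_verts :: "('v, 'e, 'o, 'm) tgraph \<Rightarrow> 'v set" where
  "node_verts G = {v \<in> verts (ugraph G). \<exists>f. vmap (typing G) v = MorV f}"

definition bang_verts :: "('v, 'e, 'o, 'm) tgraph \<Rightarrow> 'v set" where
  "bang_verts G = {v \<in> verts (ugraph G). vmap (typing G) v = BangV}"

definition fixed_arcs :: "('v, 'e, 'o, 'm) tgraph \<Rightarrow> 'e set" where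
  "fixed_arcs G = {e \<in> arcs (ugraph G). fixed_tedge (emap (typing G) e)}"

definition incident_arcs :: "('v, 'e) pre_digraph \<Rightarrow> 'v \<Rightarrow> 'e set" where
  "incident_arcs G v = in_arcs G v \<union> out_arcs G v"

definition isolated :: "('v, 'e) pre_digraph \<Rightarrow> 'v \<Rightarrow> bool" where
  "isolated G v \<longleftrightarrow> v \<in> verts G \<and> incident_arcs G v = {}"

definition U_of :: "('v, 'e, 'o, 'm) tgraph \<Rightarrow> ('v, 'e, 'o, 'm) tgraph" where
  "U_of G = full_subgraph G (verts (ugraph G) - bang_verts G)"

definition beta_of :: "('v, 'e, 'o, 'm) tgraph \<Rightarrow> ('v, 'e, 'o, 'm) tgraph" where
  "beta_of G = full_subgraph G (bang_verts G)"

definition B_of :: "('v, 'e, 'o, 'm) tgraph \<Rightarrow> 'v \<Rightarrow> ('v, 'e, 'o, 'm) tgraph" where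
  "B_of G b = full_subgraph G {v. b \<rightarrow>\<^bsub>ugraph G\<^esub> v}"

section \<open>String graphs\<close>

definition string_graph :: "('o, 'm) signature \<Rightarrow> ('v, 'e, 'o, 'm) tgraph \<Rightarrow> bool" where
  "string_graph T K \<longleftrightarrow>
     typed_graph (typegraph T) K \<and>
     (\<forall>v\<in>node_verts K.
        bij_betw (emap (typing K))
          {e \<in> incident_arcs (ugraph K) v. e \<in> fixed_arcs K}
          {t \<in> incident_arcs (typegraph T) (vmap (typing K) v). fixed_tedge t}) \<and>
     (\<forall>w\<in>wire_verts K. in_degree (ugraph K) w \<le> 1 \<and> out_degree (ugraph K) w \<le> 1)"

definition inputs :: "('v, 'e, 'o, 'm) tgraph \<Rightarrow> 'v set" where
  "inputs K = {w \<in> wire_verts K. in_arcs (ugraph K) w = {}}"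

definition outputs :: "('v, 'e, 'o, 'm) tgraph \<Rightarrow> 'v set" where
  "outputs K = {w \<in> wire_verts K. out_arcs (ugraph K) w = {}}"

definition open_subgraph ::
  "('o, 'm) signature \<Rightarrow> ('v, 'e, 'o, 'm) tgraph \<Rightarrow> ('v, 'e, 'o, 'm) tgraph \<Rightarrow> bool" where
  "open_subgraph T H K \<longleftrightarrow>
     string_graph T K \<and> string_graph T H \<and> tsubgraph H K \<and>
     (\<forall>v\<in>verts (ugraph H). \<forall>w\<in>wire_verts K - verts (ugraph H).
        \<not> v \<rightarrow>\<^bsub>ugraph K\<^esub> w \<and> \<not> w \<rightarrow>\<^bsub>ugraph K\<^esub> v) \<and>
     (\<forall>v\<in>verts (ugraph H). incident_arcs (ugraph K) v \<inter> fixed_arcs K \<subseteq> arcs (ugraph H))"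

section \<open>!-graphs\<close>

definition posetal :: "('v, 'e) pre_digraph \<Rightarrow> bool" where
  "posetal G \<longleftrightarrow> nomulti_digraph G \<and> partial_order_on (verts G) (arcs_ends G)"

definition bang_graph :: "('o, 'm) signature \<Rightarrow> ('v, 'e, 'o, 'm) tgraph \<Rightarrow> bool" where
  "bang_graph T G \<longleftrightarrow>
     typed_graph (bang_typegraph T) G \<and>
     string_graph T (U_of G) \<and>
     posetal (ugraph (beta_of G)) \<and>
     (\<forall>b\<in>bang_verts G. open_subgraph T (U_of (B_of G b)) (U_of G)) \<and>
     (\<forall>b\<in>bang_verts G. \<forall>b'\<in>bang_verts (B_of G b). tsubgraph (B_of G b') (B_of G b))"

text \<open>
  Test objects of the two universally quantified categorical properties below have carriers in
  \<open>nat\<close>; as all graphs are finite, these represent every isomorphism class.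
\<close>

definition bang_mono ::
  "('o, 'm) signature \<Rightarrow> ('v, 'e, 'o, 'm) tgraph \<Rightarrow> ('v, 'w, 'e, 'f) gmap \<Rightarrow>
     ('w, 'f, 'o, 'm) tgraph \<Rightarrow> bool" where
  "bang_mono T A f B \<longleftrightarrow>
     bang_graph T A \<and> bang_graph T B \<and> tmorphism A f B \<and>
     (\<forall>(X :: (nat, nat, 'o, 'm) tgraph) p q.
        bang_graph T X \<and> tmorphism X p A \<and> tmorphism X q A \<and>
        gmap_eq (ugraph X) (f \<circ>\<^sub>g p) (f \<circ>\<^sub>g q) \<longrightarrow> gmap_eq (ugraph X) p q)"

text \<open>\<open>is_pushout T A f B g C p q P\<close>: the square \<open>p \<circ> f = q \<circ> g\<close> with \<open>f : A \<rightarrow> B\<close>,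
  \<open>g : A \<rightarrow> C\<close>, \<open>p : B \<rightarrow> P\<close>, \<open>q : C \<rightarrow> P\<close> is a pushout of typed graphs.\<close>

definition is_pushout ::
  "('o, 'm) signature \<Rightarrow> ('va, 'ea, 'o, 'm) tgraph \<Rightarrow>
     ('va, 'vb, 'ea, 'eb) gmap \<Rightarrow> ('vb, 'eb, 'o, 'm) tgraph \<Rightarrow>
     ('va, 'vc, 'ea, 'ec) gmap \<Rightarrow> ('vc, 'ec, 'o, 'm) tgraph \<Rightarrow>
     ('vb, 'vp, 'eb, 'ep) gmap \<Rightarrow> ('vc, 'vp, 'ec, 'ep) gmap \<Rightarrow>
     ('vp, 'ep, 'o, 'm) tgraph \<Rightarrow> bool" where
  "is_pushout T A f B g C p q P \<longleftrightarrow>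
     typed_graph (bang_typegraph T) A \<and> typed_graph (bang_typegraph T) B \<and>
     typed_graph (bang_typegraph T) C \<and> typed_graph (bang_typegraph T) P \<and>
     tmorphism A f B \<and> tmorphism A g C \<and> tmorphism B p P \<and> tmorphism C q P \<and>
     gmap_eq (ugraph A) (p \<circ>\<^sub>g f) (q \<circ>\<^sub>g g) \<and>
     (\<forall>(Q :: (nat, nat, 'o, 'm) tgraph) s t.
        typed_graph (bang_typegraph T) Q \<and> tmorphism B s Q \<and> tmorphism C t Q \<and>
        gmap_eq (ugraph A) (s \<circ>\<^sub>g f) (t \<circ>\<^sub>g g) \<longrightarrow>
        (\<exists>u. tmorphism P u Q \<and>
             gmap_eq (ugraph B) (u \<circ>\<^sub>g p) s \<and> gmap_eq (ugraph C) (u \<circ>\<^sub>g q) t \<and>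
             (\<forall>u'. tmorphism P u' Q \<and>
                gmap_eq (ugraph B) (u' \<circ>\<^sub>g p) s \<and> gmap_eq (ugraph C) (u' \<circ>\<^sub>g q) t \<longrightarrow>
                gmap_eq (ugraph P) u' u)))"

section \<open>!-graph rewrite rules\<close>

definition In_bang :: "('v, 'e, 'o, 'm) tgraph \<Rightarrow> ('v, 'e, 'o, 'm) tgraph" where
  "In_bang G = full_subgraph G (bang_verts G \<union> inputs (U_of G))"

definition Out_bang :: "('v, 'e, 'o, 'm) tgraph \<Rightarrow> ('v, 'e, 'o, 'm) tgraph" where
  "Out_bang G = full_subgraph G (bang_verts G \<union> outputs (U_of G))"

definition Bound_bang :: "('v, 'e, 'o, 'm) tgraph \<Rightarrow> ('v, 'e, 'o, 'm) tgraph" where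
  "Bound_bang G =
     (let S = bang_verts G \<union> inputs (U_of G) \<union> outputs (U_of G) in
      G\<lparr>ugraph := (ugraph G)\<lparr>verts := S,
          arcs := {e \<in> arcs (ugraph G). tail (ugraph G) e \<in> bang_verts G \<and> head (ugraph G) e \<in> S}\<rparr>\<rparr>)"

text \<open>
  All inclusions of subgraphs below (\<open>In_bang L\<close> into \<open>Bound_bang L\<close>, and so on) are
  given by \<open>gmap_id\<close>.
\<close>

definition rewrite_rule ::
  "('o, 'm) signature \<Rightarrow> ('vl, 'el, 'o, 'm) tgraph \<Rightarrow> ('vi, 'vl, 'ei, 'el) gmap \<Rightarrow>
     ('vi, 'ei, 'o, 'm) tgraph \<Rightarrow> ('vi, 'vr, 'ei, 'er) gmap \<Rightarrow>
     ('vr, 'er, 'o, 'm) tgraph \<Rightarrow> bool" where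
  "rewrite_rule T L i1 I i2 R \<longleftrightarrow>
     bang_graph T L \<and> bang_graph T I \<and> bang_graph T R \<and>
     tmorphism I i1 L \<and> tmorphism I i2 R \<and>
     (\<forall>w\<in>wire_verts (U_of L). \<not> isolated (ugraph (U_of L)) w) \<and>
     (\<forall>w\<in>wire_verts (U_of R). \<not> isolated (ugraph (U_of R)) w) \<and>
     (\<exists>\<phi>\<^sub>I \<phi>\<^sub>O \<phi>\<^sub>L \<phi>\<^sub>R.
        tiso (In_bang L) \<phi>\<^sub>I (In_bang R) \<and>
        tiso (Out_bang L) \<phi>\<^sub>O (Out_bang R) \<and>
        tiso (Bound_bang L) \<phi>\<^sub>L I \<and>
        tiso (Bound_bang R) \<phi>\<^sub>R I \<and>
        (let j1 = \<phi>\<^sub>L \<circ>\<^sub>g gmap_id; j2 = \<phi>\<^sub>R \<circ>\<^sub>g gmap_id;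
             k1 = \<phi>\<^sub>L \<circ>\<^sub>g gmap_id; k2 = \<phi>\<^sub>R \<circ>\<^sub>g gmap_id in
         gmap_eq (ugraph (In_bang L)) (i1 \<circ>\<^sub>g j1) gmap_id \<and>
         gmap_eq (ugraph (In_bang R)) (i2 \<circ>\<^sub>g j2) gmap_id \<and>
         gmap_eq (ugraph (Out_bang L)) (i1 \<circ>\<^sub>g k1) gmap_id \<and>
         gmap_eq (ugraph (Out_bang R)) (i2 \<circ>\<^sub>g k2) gmap_id \<and>
         gmap_eq (ugraph (In_bang L)) (j2 \<circ>\<^sub>g \<phi>\<^sub>I) j1 \<and>
         gmap_eq (ugraph (Out_bang L)) (k2 \<circ>\<^sub>g \<phi>\<^sub>O) k1))"

end

theory Submission
  imports Defs
begin

text \<open>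
  A rewrite rule amounts to a span whose legs identify \<open>I\<close> with the boundaries of \<open>L\<close> and \<open>R\<close>, such
  that inputs correspond to inputs and outputs to outputs. The interior of \<open>L\<close> contributes no
  !-vertices, inputs or outputs to \<open>G\<close>, so the boundary of \<open>G\<close> lies in the image of \<open>D\<close>, and
  \<open>J\<close> is its preimage. A wire-vertex of \<open>D\<close> is an input in \<open>G\<close> iff it is one in \<open>H\<close>: outside \<open>I\<close> both
  graphs look like \<open>D\<close> there, and on \<open>I\<close> the inputs of \<open>L\<close> and \<open>R\<close> agree; likewise for outputs.
  Since \<open>i\<^sub>1\<close> and \<open>i\<^sub>2\<close> are injective by the rule conditions, the pushouts are gluings along the
  image of \<open>I\<close>.
\<close>

section \<open>Typed graphs and their morphisms\<close>

lemma tmorphism_iff: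
  "tmorphism A f B \<longleftrightarrow>
     (\<forall>v\<in>verts (ugraph A). vmap f v \<in> verts (ugraph B) \<and>
        vmap (typing B) (vmap f v) = vmap (typing A) v) \<and>
     (\<forall>e\<in>arcs (ugraph A). emap f e \<in> arcs (ugraph B) \<and>
        tail (ugraph B) (emap f e) = vmap f (tail (ugraph A) e) \<and>
        head (ugraph B) (emap f e) = vmap f (head (ugraph A) e) \<and>
        emap (typing B) (emap f e) = emap (typing A) e)"
  unfolding tmorphism_def graph_hom_def gmap_eq_def gmap_comp_def by auto

lemma typed_graph_iff:
  "typed_graph TG G \<longleftrightarrow>
     finite (verts (ugraph G)) \<and> finite (arcs (ugraph G)) \<and>
     (\<forall>v\<in>verts (ugraph G). vmap (typing G) v \<in> verts TG) \<and>
     (\<forall>e\<in>arcs (ugraph G). tail (ugraph G) e \<in> verts (ugraph G) \<and>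
        head (ugraph G) e \<in> verts (ugraph G) \<and> emap (typing G) e \<in> arcs TG \<and>
        tail TG (emap (typing G) e) = vmap (typing G) (tail (ugraph G) e) \<and>
        head TG (emap (typing G) e) = vmap (typing G) (head (ugraph G) e))"
  unfolding typed_graph_def graph_hom_def fin_digraph_def fin_digraph_axioms_def wf_digraph_def
  by auto

lemma tmorphism_id: "tmorphism A gmap_id A"
  by (simp add: tmorphism_iff gmap_id_def)

lemma tmorphism_comp:
  "tmorphism A f B \<Longrightarrow> tmorphism B g C \<Longrightarrow>
    wf_digraph (ugraph A) \<Longrightarrow> tmorphism A (g \<circ>\<^sub>g f) C"
  by (auto simp: tmorphism_iff gmap_comp_def)

lemma typed_graph_wf: "typed_graph TG G \<Longrightarrow> wf_digraph (ugraph G)"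
  by (simp add: typed_graph_def fin_digraph_def)

text \<open>Finiteness lets the carriers be numbered. Since \<open>is_pushout\<close> tests only
  against graphs over \<open>nat\<close>, a target over other types is replaced by such a copy, and
  maps into it are brought back along the retraction \<open>k'\<close>.\<close>

lemma typed_graph_nat_copy:
  assumes "typed_graph TG Q"
  obtains Q' :: "(nat, nat, 'o, 'm) tgraph" and k k' where
    "typed_graph TG Q'" "tmorphism Q k Q'" "tmorphism Q' k' Q"
    "gmap_eq (ugraph Q) (k' \<circ>\<^sub>g k) gmap_id"
proof -
  let ?V = "verts (ugraph Q)" and ?E = "arcs (ugraph Q)"
  from assms have fin: "finite ?V" "finite ?E" by (auto simp: typed_graph_iff)
  obtain kv :: "_ \<Rightarrow> nat" where kv: "inj_on kv ?V"
    using finite_imp_inj_to_nat_seg[OF fin(1)] by blast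
  obtain ke :: "_ \<Rightarrow> nat" where ke: "inj_on ke ?E"
    using finite_imp_inj_to_nat_seg[OF fin(2)] by blast
  let ?iv = "inv_into ?V kv" and ?ie = "inv_into ?E ke"
  define Q' :: "(nat, nat, 'o, 'm) tgraph" where
    "Q' = \<lparr>ugraph = \<lparr>verts = kv ` ?V, arcs = ke ` ?E,
             tail = (\<lambda>n. kv (tail (ugraph Q) (?ie n))), head = (\<lambda>n. kv (head (ugraph Q) (?ie n)))\<rparr>,
           typing = \<lparr>vmap = vmap (typing Q) \<circ> ?iv, emap = emap (typing Q) \<circ> ?ie\<rparr>\<rparr>"
  have inv [simp]: "\<And>v. v \<in> ?V \<Longrightarrow> ?iv (kv v) = v" "\<And>e. e \<in> ?E \<Longrightarrow> ?ie (ke e) = e"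
    using kv ke by auto
  show thesis
  proof
    show "typed_graph TG Q'" using assms by (auto simp: typed_graph_iff Q'_def)
    show "tmorphism Q \<lparr>vmap = kv, emap = ke\<rparr> Q'" using assms
      by (auto simp: typed_graph_iff tmorphism_iff Q'_def)
    show "tmorphism Q' \<lparr>vmap = ?iv, emap = ?ie\<rparr> Q" using assms
      by (auto simp: typed_graph_iff tmorphism_iff Q'_def)
    show "gmap_eq (ugraph Q) (\<lparr>vmap = ?iv, emap = ?ie\<rparr> \<circ>\<^sub>g \<lparr>vmap = kv, emap = ke\<rparr>) gmap_id"
      by (auto simp: gmap_eq_def gmap_comp_def gmap_id_def)
  qed
qed

section \<open>Pushouts along monomorphisms\<close>

text \<open>The universal property of \<^const>\<open>is_pushout\<close>, for test objects over arbitrary types.\<close>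

lemma pushout_factor:
  assumes po: "is_pushout T A f B g C p q P"
    and Q: "typed_graph (bang_typegraph T) Q" "tmorphism B s Q" "tmorphism C t Q"
      "gmap_eq (ugraph A) (s \<circ>\<^sub>g f) (t \<circ>\<^sub>g g)"
  obtains u where "tmorphism P u Q" "gmap_eq (ugraph B) (u \<circ>\<^sub>g p) s"
    "gmap_eq (ugraph C) (u \<circ>\<^sub>g q) t"
proof -
  obtain Q' :: "(nat, nat, 'a, 'b) tgraph" and k k' where
    Q': "typed_graph (bang_typegraph T) Q'" "tmorphism Q k Q'" "tmorphism Q' k' Q"
    "gmap_eq (ugraph Q) (k' \<circ>\<^sub>g k) gmap_id"
    using typed_graph_nat_copy[OF Q(1)] .
  have wf: "wf_digraph (ugraph A)" "wf_digraph (ugraph B)" "wf_digraph (ugraph C)"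
    "wf_digraph (ugraph P)"
    using po by (auto simp: is_pushout_def intro: typed_graph_wf)
  have "gmap_eq (ugraph A) (k \<circ>\<^sub>g s \<circ>\<^sub>g f) (k \<circ>\<^sub>g t \<circ>\<^sub>g g)"
    using Q(4) by (auto simp: gmap_eq_def gmap_comp_def)
  then obtain u where u: "tmorphism P u Q'" "gmap_eq (ugraph B) (u \<circ>\<^sub>g p) (k \<circ>\<^sub>g s)"
      "gmap_eq (ugraph C) (u \<circ>\<^sub>g q) (k \<circ>\<^sub>g t)"
    using po Q'(1) tmorphism_comp[OF Q(2) Q'(2) wf(2)] tmorphism_comp[OF Q(3) Q'(2) wf(3)]
    unfolding is_pushout_def by blast
  show thesis
  proof
    show "tmorphism P (k' \<circ>\<^sub>g u) Q" by (rule tmorphism_comp[OF u(1) Q'(3) wf(4)])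
    show "gmap_eq (ugraph B) (k' \<circ>\<^sub>g u \<circ>\<^sub>g p) s" "gmap_eq (ugraph C) (k' \<circ>\<^sub>g u \<circ>\<^sub>g q) t"
      using u Q'(4) Q(2,3) by (auto simp: gmap_eq_def gmap_comp_def gmap_id_def tmorphism_iff)
  qed
qed

text \<open>Pushed along \<open>k\<close> into a copy over \<open>nat\<close>, both maps mediate the
  same cocone and so agree there; the retraction \<open>k'\<close> cancels \<open>k\<close>.\<close>

lemma pushout_unique:
  assumes po: "is_pushout T A f B g C p q P"
    and Q: "typed_graph (bang_typegraph T) Q"
    and u: "tmorphism P u Q" "tmorphism P u' Q"
    and eq: "gmap_eq (ugraph B) (u \<circ>\<^sub>g p) (u' \<circ>\<^sub>g p)" "gmap_eq (ugraph C) (u \<circ>\<^sub>g q) (u' \<circ>\<^sub>g q)"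
  shows "gmap_eq (ugraph P) u u'"
proof -
  obtain Q' :: "(nat, nat, 'a, 'b) tgraph" and k k' where
    Q': "typed_graph (bang_typegraph T) Q'" "tmorphism Q k Q'" "tmorphism Q' k' Q"
    "gmap_eq (ugraph Q) (k' \<circ>\<^sub>g k) gmap_id"
    using typed_graph_nat_copy[OF Q(1)] .
  have wf: "wf_digraph (ugraph B)" "wf_digraph (ugraph C)" "wf_digraph (ugraph P)"
    and pq: "tmorphism B p P" "tmorphism C q P" "gmap_eq (ugraph A) (p \<circ>\<^sub>g f) (q \<circ>\<^sub>g g)"
    using po by (auto simp: is_pushout_def intro: typed_graph_wf)
  let ?s = "k \<circ>\<^sub>g u \<circ>\<^sub>g p" and ?t = "k \<circ>\<^sub>g u \<circ>\<^sub>g q"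
  have ku: "tmorphism P (k \<circ>\<^sub>g u) Q'" "tmorphism P (k \<circ>\<^sub>g u') Q'"
    using tmorphism_comp[OF _ Q'(2) wf(3)] u by auto
  have "gmap_eq (ugraph A) (?s \<circ>\<^sub>g f) (?t \<circ>\<^sub>g g)"
    using pq(3) by (auto simp: gmap_eq_def gmap_comp_def)
  then obtain w where w: "\<And>u''. tmorphism P u'' Q' \<Longrightarrow> gmap_eq (ugraph B) (u'' \<circ>\<^sub>g p) ?s \<Longrightarrow>
      gmap_eq (ugraph C) (u'' \<circ>\<^sub>g q) ?t \<Longrightarrow> gmap_eq (ugraph P) u'' w"
    using po Q'(1) tmorphism_comp[OF pq(1) ku(1) wf(1)] tmorphism_comp[OF pq(2) ku(1) wf(2)]
    unfolding is_pushout_def by blast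
  have "gmap_eq (ugraph P) (k \<circ>\<^sub>g u) w" by (rule w[OF ku(1)]) (auto simp: gmap_eq_def)
  moreover have "gmap_eq (ugraph P) (k \<circ>\<^sub>g u') w"
    by (rule w[OF ku(2)]) (use eq in \<open>auto simp: gmap_eq_def gmap_comp_def\<close>)
  ultimately have *: "gmap_eq (ugraph P) (k' \<circ>\<^sub>g k \<circ>\<^sub>g u) (k' \<circ>\<^sub>g k \<circ>\<^sub>g u')"
    by (auto simp: gmap_eq_def gmap_comp_def)
  then show ?thesis
    using Q'(4) u by (simp add: gmap_eq_def gmap_comp_def gmap_id_def tmorphism_iff)
qed

text \<open>The joint image \<open>P'\<close> of the two legs is a subgraph of \<open>P\<close> that
  receives both, so a mediating map \<open>u\<close> into it exists. Read as an endomorphism of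
  \<open>P\<close>, \<open>u\<close> agrees with the identity on both legs, hence is the identity,
  and \<open>P\<close> is contained in \<open>P'\<close>.\<close>

lemma pushout_jointly_surj:
  assumes po: "is_pushout T A f B g C p q P"
  shows "verts (ugraph P) = vmap p ` verts (ugraph B) \<union> vmap q ` verts (ugraph C)"
    and "arcs (ugraph P) = emap p ` arcs (ugraph B) \<union> emap q ` arcs (ugraph C)"
proof -
  define P' where "P' = P\<lparr>ugraph := (ugraph P)
    \<lparr>verts := vmap p ` verts (ugraph B) \<union> vmap q ` verts (ugraph C),
     arcs := emap p ` arcs (ugraph B) \<union> emap q ` arcs (ugraph C)\<rparr>\<rparr>"
  have P: "typed_graph (bang_typegraph T) P" and p: "tmorphism B p P" and q: "tmorphism C q P"
    and BC: "typed_graph (bang_typegraph T) B" "typed_graph (bang_typegraph T) C"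
    and eq: "gmap_eq (ugraph A) (p \<circ>\<^sub>g f) (q \<circ>\<^sub>g g)"
    using po by (auto simp: is_pushout_def)
  have "typed_graph (bang_typegraph T) P'"
    using P p q BC unfolding typed_graph_iff tmorphism_iff P'_def by auto
  moreover have "tmorphism B p P'" "tmorphism C q P'"
    using p q by (auto simp: tmorphism_iff P'_def)
  ultimately obtain u where u: "tmorphism P u P'" "gmap_eq (ugraph B) (u \<circ>\<^sub>g p) p"
    "gmap_eq (ugraph C) (u \<circ>\<^sub>g q) q"
    using pushout_factor[OF po _ _ _ eq] by blast
  have sub: "verts (ugraph P') \<subseteq> verts (ugraph P)" "arcs (ugraph P') \<subseteq> arcs (ugraph P)"
    using p q by (auto simp: P'_def tmorphism_iff)
  have P'_simps: "tail (ugraph P') = tail (ugraph P)" "head (ugraph P') = head (ugraph P)"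
    "typing P' = typing P"
    by (auto simp: P'_def)
  have "tmorphism P u P"
    using u(1) sub unfolding tmorphism_iff P'_simps by blast
  then have "gmap_eq (ugraph P) u gmap_id"
    by (rule pushout_unique[OF po P _ tmorphism_id])
      (use u in \<open>auto simp: gmap_eq_def gmap_comp_def gmap_id_def\<close>)
  then have "verts (ugraph P) \<subseteq> verts (ugraph P')" "arcs (ugraph P) \<subseteq> arcs (ugraph P')"
    using u(1) by (auto simp: gmap_eq_def gmap_id_def tmorphism_iff)
  with sub show
    "verts (ugraph P) = vmap p ` verts (ugraph B) \<union> vmap q ` verts (ugraph C)"
    "arcs (ugraph P) = emap p ` arcs (ugraph B) \<union> emap q ` arcs (ugraph C)"
    by (auto simp: P'_def)
qed

text \<open>Both facts are read off the concrete pushout \<open>(B - f(A)) + C\<close>, through which the given one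
  factors.\<close>

lemma pushout_mono:
  assumes po: "is_pushout T A f B g C p q P"
    and fv: "inj_on (vmap f) (verts (ugraph A))" and fe: "inj_on (emap f) (arcs (ugraph A))"
  shows "inj_on (vmap q) (verts (ugraph C))" "inj_on (emap q) (arcs (ugraph C))"
    and "\<And>x y. x \<in> verts (ugraph B) \<Longrightarrow> y \<in> verts (ugraph C) \<Longrightarrow> vmap p x = vmap q y \<Longrightarrow>
           \<exists>z\<in>verts (ugraph A). x = vmap f z \<and> y = vmap g z"
proof -
  let ?VA = "verts (ugraph A)" and ?EA = "arcs (ugraph A)"
  let ?VB = "verts (ugraph B)" and ?EB = "arcs (ugraph B)"
  let ?VC = "verts (ugraph C)" and ?EC = "arcs (ugraph C)"
  \<comment> \<open>\<open>sv\<close> and \<open>se\<close> form the leg from \<open>B\<close>: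
    whatever lies in the image of \<open>f\<close> moves to its partner in \<open>C\<close>, which
    is well determined because \<open>f\<close> is injective; everything else stays in the left
    summand.\<close>
  define sv where "sv x = (if x \<in> vmap f ` ?VA
      then Inr (vmap g (inv_into ?VA (vmap f) x)) else Inl x)" for x
  define se where "se e = (if e \<in> emap f ` ?EA
      then Inr (emap g (inv_into ?EA (emap f) e)) else Inl e)" for e
  define Q where "Q = \<lparr>ugraph = \<lparr>verts = Inl ` (?VB - vmap f ` ?VA) \<union> Inr ` ?VC,
      arcs = Inl ` (?EB - emap f ` ?EA) \<union> Inr ` ?EC,
      tail = case_sum (sv \<circ> tail (ugraph B)) (Inr \<circ> tail (ugraph C)),
      head = case_sum (sv \<circ> head (ugraph B)) (Inr \<circ> head (ugraph C))\<rparr>,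
      typing = \<lparr>vmap = case_sum (vmap (typing B)) (vmap (typing C)),
                emap = case_sum (emap (typing B)) (emap (typing C))\<rparr>\<rparr>"
  have AB: "typed_graph (bang_typegraph T) A" "typed_graph (bang_typegraph T) B"
     "typed_graph (bang_typegraph T) C"
     "tmorphism A f B" "tmorphism A g C"
    using po by (auto simp: is_pushout_def)
  have sv_f [simp]: "sv (vmap f z) = Inr (vmap g z)" if "z \<in> ?VA" for z
    using that fv by (simp add: sv_def)
  have se_f [simp]: "se (emap f z) = Inr (emap g z)" if "z \<in> ?EA" for z
    using that fe by (simp add: se_def)
  have sv_typ: "sv x \<in> verts (ugraph Q)" "vmap (typing Q) (sv x) = vmap (typing B) x"
    if "x \<in> ?VB" for x
  proof -
    have "sv x \<in> verts (ugraph Q) \<and> vmap (typing Q) (sv x) = vmap (typing B) x"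
    proof (cases "x \<in> vmap f ` ?VA")
      case True
      then obtain z where "z \<in> ?VA" "x = vmap f z" by auto
      then show ?thesis using AB(4,5) by (simp add: Q_def tmorphism_iff)
    next
      case False
      then show ?thesis using that by (simp add: Q_def sv_def)
    qed
    then show "sv x \<in> verts (ugraph Q)" "vmap (typing Q) (sv x) = vmap (typing B) x" by auto
  qed
  have "typed_graph (bang_typegraph T) Q"
    unfolding typed_graph_iff
  proof (intro conjI ballI)
    show "finite (verts (ugraph Q))" "finite (arcs (ugraph Q))"
      using AB by (auto simp: Q_def typed_graph_iff)
    show "vmap (typing Q) v \<in> verts (bang_typegraph T)" if "v \<in> verts (ugraph Q)" for v
      using that AB by (auto simp: Q_def typed_graph_iff)
    fix e assume "e \<in> arcs (ugraph Q)"
    then consider (l) e' where "e = Inl e'" "e' \<in> ?EB" | (r) e' where "e = Inr e'" "e' \<in> ?EC"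
      by (auto simp: Q_def)
    then have "tail (ugraph Q) e \<in> verts (ugraph Q) \<and> head (ugraph Q) e \<in> verts (ugraph Q) \<and>
      emap (typing Q) e \<in> arcs (bang_typegraph T) \<and>
      tail (bang_typegraph T) (emap (typing Q) e) = vmap (typing Q) (tail (ugraph Q) e) \<and>
      head (bang_typegraph T) (emap (typing Q) e) = vmap (typing Q) (head (ugraph Q) e)"
    proof cases
      case l
      have "tail (ugraph Q) e = sv (tail (ugraph B) e')" "head (ugraph Q) e = sv (head (ugraph B) e')"
        "emap (typing Q) e = emap (typing B) e'"
        by (auto simp: Q_def l)
      then show ?thesis using sv_typ l AB(2) by (simp add: typed_graph_iff)
    next
      case r
      then show ?thesis using AB(3) by (simp add: Q_def typed_graph_iff)
    qed
    then show "tail (ugraph Q) e \<in> verts (ugraph Q)" "head (ugraph Q) e \<in> verts (ugraph Q)"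
      "emap (typing Q) e \<in> arcs (bang_typegraph T)"
      "tail (bang_typegraph T) (emap (typing Q) e) = vmap (typing Q) (tail (ugraph Q) e)"
      "head (bang_typegraph T) (emap (typing Q) e) = vmap (typing Q) (head (ugraph Q) e)" by auto
  qed
  moreover have "tmorphism B \<lparr>vmap = sv, emap = se\<rparr> Q"
    unfolding tmorphism_iff gmap.simps
  proof (intro conjI ballI)
    fix e assume e: "e \<in> ?EB"
    have "se e \<in> arcs (ugraph Q) \<and> tail (ugraph Q) (se e) = sv (tail (ugraph B) e) \<and>
      head (ugraph Q) (se e) = sv (head (ugraph B) e) \<and>
      emap (typing Q) (se e) = emap (typing B) e"
    proof (cases "e \<in> emap f ` ?EA")
      case True
      then obtain z where z: "z \<in> ?EA" "e = emap f z" by auto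
      moreover have "tail (ugraph A) z \<in> ?VA" "head (ugraph A) z \<in> ?VA"
        using z AB(1) by (auto simp: typed_graph_iff)
      ultimately show ?thesis using AB(4,5) by (simp add: Q_def tmorphism_iff)
    next
      case False
      then show ?thesis using e by (simp add: Q_def se_def)
    qed
    then show "se e \<in> arcs (ugraph Q)" "tail (ugraph Q) (se e) = sv (tail (ugraph B) e)"
      "head (ugraph Q) (se e) = sv (head (ugraph B) e)"
      "emap (typing Q) (se e) = emap (typing B) e" by auto
  qed (use sv_typ in auto)
  moreover have "tmorphism C \<lparr>vmap = Inr, emap = Inr\<rparr> Q"
    by (auto simp: tmorphism_iff Q_def)
  moreover have "gmap_eq (ugraph A) (\<lparr>vmap = sv, emap = se\<rparr> \<circ>\<^sub>g f) (\<lparr>vmap = Inr, emap = Inr\<rparr> \<circ>\<^sub>g g)"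
    by (auto simp: gmap_eq_def gmap_comp_def)
  \<comment> \<open>It suffices that \<open>Q\<close> carries a cocone: followed by the mediating
    map \<open>u\<close>, the leg \<open>q\<close> becomes the injection \<open>Inr\<close>, so
    \<open>q\<close> is injective.\<close>
  ultimately obtain u where
    u: "gmap_eq (ugraph B) (u \<circ>\<^sub>g p) \<lparr>vmap = sv, emap = se\<rparr>"
       "gmap_eq (ugraph C) (u \<circ>\<^sub>g q) \<lparr>vmap = Inr, emap = Inr\<rparr>"
    using pushout_factor[OF po] by blast
  have uq: "vmap u (vmap q y) = Inr y" if "y \<in> ?VC" for y
    using u(2) that by (auto simp: gmap_eq_def gmap_comp_def)
  have uq': "emap u (emap q y) = Inr y" if "y \<in> ?EC" for y
    using u(2) that by (auto simp: gmap_eq_def gmap_comp_def)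
  show "inj_on (vmap q) ?VC" using uq by (metis Inr_inject inj_onI)
  show "inj_on (emap q) ?EC" using uq' by (metis Inr_inject inj_onI)
  fix x y assume xy: "x \<in> ?VB" "y \<in> ?VC" "vmap p x = vmap q y"
  \<comment> \<open>\<open>u\<close> sends the common image of \<open>x\<close> and \<open>y\<close>
    both to \<open>sv x\<close> and to \<open>Inr y\<close>, and \<open>sv\<close> takes values in
    the right summand only on the image of \<open>f\<close>.\<close>
  then have *: "sv x = Inr y" using uq[of y] u(1) by (auto simp: gmap_eq_def gmap_comp_def)
  then obtain z where "z \<in> ?VA" "x = vmap f z" by (auto simp: sv_def split: if_splits)
  with * show "\<exists>z\<in>?VA. x = vmap f z \<and> y = vmap g z" by auto
qed

section \<open>Boundaries of !-graphs\<close>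

text \<open>\<open>end_of True\<close> and \<open>end_of False\<close> are head and tail, so that \<open>free_wires True\<close> are the inputs
  and \<open>free_wires False\<close> the outputs.\<close>

definition end_of :: "bool \<Rightarrow> ('v, 'e) pre_digraph \<Rightarrow> 'e \<Rightarrow> 'v" where
  "end_of b G e = (if b then head G e else tail G e)"

text \<open>In a typed graph these are the arcs of \<open>U_of G\<close>. Testing the tail is
  enough, since the typing allows arcs into a !-vertex only from !-vertices.\<close>

definition plain_arcs :: "('v, 'e, 'o, 'm) tgraph \<Rightarrow> 'e set" where
  "plain_arcs G = {e \<in> arcs (ugraph G). tail (ugraph G) e \<notin> bang_verts G}"

definition free_wires :: "bool \<Rightarrow> ('v, 'e, 'o, 'm) tgraph \<Rightarrow> 'v set" where
  "free_wires b G = {w \<in> wire_verts G. \<forall>e\<in>plain_arcs G. end_of b (ugraph G) e \<noteq> w}"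

definition bound_verts :: "('v, 'e, 'o, 'm) tgraph \<Rightarrow> 'v set" where
  "bound_verts G = bang_verts G \<union> free_wires True G \<union> free_wires False G"

definition bang_arcs :: "('v, 'e, 'o, 'm) tgraph \<Rightarrow> 'v set \<Rightarrow> 'e set" where
  "bang_arcs G S = {e \<in> arcs (ugraph G). tail (ugraph G) e \<in> bang_verts G \<and> head (ugraph G) e \<in> S}"

definition bang_sub :: "('v, 'e, 'o, 'm) tgraph \<Rightarrow> 'v set \<Rightarrow> ('v, 'e, 'o, 'm) tgraph" where
  "bang_sub G S = G\<lparr>ugraph := (ugraph G)\<lparr>verts := S, arcs := bang_arcs G S\<rparr>\<rparr>"

text \<open>Common form of \<open>In_bang\<close> (for \<open>True\<close>) and
  \<open>Out_bang\<close> (for \<open>False\<close>), so that one argument treats both.\<close>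

definition face :: "bool \<Rightarrow> ('v, 'e, 'o, 'm) tgraph \<Rightarrow> ('v, 'e, 'o, 'm) tgraph" where
  "face b G = full_subgraph G (bang_verts G \<union> free_wires b G)"

lemma bang_sub_simps [simp]:
  "verts (ugraph (bang_sub G S)) = S" "arcs (ugraph (bang_sub G S)) = bang_arcs G S"
  "tail (ugraph (bang_sub G S)) = tail (ugraph G)" "head (ugraph (bang_sub G S)) = head (ugraph G)"
  "typing (bang_sub G S) = typing G"
  by (auto simp: bang_sub_def)

lemma full_subgraph_simps [simp]:
  "verts (ugraph (full_subgraph G S)) = S"
  "arcs (ugraph (full_subgraph G S)) =
     {e \<in> arcs (ugraph G). tail (ugraph G) e \<in> S \<and> head (ugraph G) e \<in> S}"
  "tail (ugraph (full_subgraph G S)) = tail (ugraph G)"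
  "head (ugraph (full_subgraph G S)) = head (ugraph G)"
  "typing (full_subgraph G S) = typing G"
  by (auto simp: full_subgraph_def induce_subgraph_def)

text \<open>The only edge of the typegraph with head \<open>BangV\<close> is the self-loop, whose
  tail is \<open>BangV\<close> too.\<close>

lemma typed_arc_head_bang:
  assumes G: "typed_graph (bang_typegraph T) G" and e: "e \<in> arcs (ugraph G)"
    and h: "head (ugraph G) e \<in> bang_verts G"
  shows "tail (ugraph G) e \<in> bang_verts G"
proof -
  let ?t = "emap (typing G) e"
  have t: "?t \<in> arcs (bang_typegraph T)" "tedge_tail T ?t = vmap (typing G) (tail (ugraph G) e)"
    "tedge_head T ?t = BangV" "tail (ugraph G) e \<in> verts (ugraph G)"
    using G e h by (auto simp: typed_graph_iff bang_verts_def bang_typegraph_def)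
  have "tedge_tail T ?t = BangV"
    using t(1,3) by (cases ?t) (auto simp: bang_typegraph_def typegraph_def)
  then show ?thesis using t by (simp add: bang_verts_def)
qed

lemma arcs_U_of:
  assumes "typed_graph (bang_typegraph T) G"
  shows "arcs (ugraph (U_of G)) = plain_arcs G"
  using assms typed_arc_head_bang[OF assms]
  by (auto simp: U_of_def plain_arcs_def typed_graph_iff)

lemma U_of_simps [simp]:
  "verts (ugraph (U_of G)) = verts (ugraph G) - bang_verts G"
  "tail (ugraph (U_of G)) = tail (ugraph G)" "head (ugraph (U_of G)) = head (ugraph G)"
  "typing (U_of G) = typing G"
  "wire_verts (U_of G) = wire_verts G"
  by (auto simp: U_of_def wire_verts_def bang_verts_def)

lemma free_wires_inputs:
  assumes "typed_graph (bang_typegraph T) G"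
  shows "inputs (U_of G) = free_wires True G" "outputs (U_of G) = free_wires False G"
  using arcs_U_of[OF assms]
  by (auto simp: inputs_def outputs_def free_wires_def end_of_def in_arcs_def out_arcs_def)

lemma bang_face_simps:
  assumes "typed_graph (bang_typegraph T) G"
  shows "In_bang G = face True G" "Out_bang G = face False G"
    "Bound_bang G = bang_sub G (bound_verts G)"
  using free_wires_inputs[OF assms]
  by (simp_all add: In_bang_def Out_bang_def face_def Bound_bang_def bang_sub_def bound_verts_def
      bang_arcs_def)

lemma free_wires_subset: "free_wires b G \<subseteq> bound_verts G"
  by (cases b) (auto simp: bound_verts_def)

lemma wire_not_bang: "w \<in> wire_verts G \<Longrightarrow> w \<notin> bang_verts G"
  by (auto simp: wire_verts_def bang_verts_def)

lemma free_wires_wire: "w \<in> free_wires b G \<Longrightarrow> w \<in> wire_verts G"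
  by (simp add: free_wires_def)

text \<open>A plain arc can neither enter an input nor leave an output, and none enters a !-vertex.
  So every arc of the full subgraph starts at a !-vertex, and the face lies inside
  \<open>Bound_bang G\<close> although the latter is not a full subgraph by definition.\<close>

lemma arcs_face:
  assumes "typed_graph (bang_typegraph T) G"
  shows "arcs (ugraph (face b G)) = bang_arcs G (bang_verts G \<union> free_wires b G)"
proof -
  have "tail (ugraph G) e \<in> bang_verts G"
    if "e \<in> arcs (ugraph G)" "tail (ugraph G) e \<in> bang_verts G \<union> free_wires b G"
      "head (ugraph G) e \<in> bang_verts G \<union> free_wires b G" for e
    using that typed_arc_head_bang[OF assms that(1)]
    by (cases b) (auto simp: free_wires_def plain_arcs_def end_of_def)
  then show ?thesis by (auto simp: face_def bang_arcs_def)
qed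

lemma verts_face [simp]: "verts (ugraph (face b G)) = bang_verts G \<union> free_wires b G"
  and face_simps [simp]: "tail (ugraph (face b G)) = tail (ugraph G)"
  "head (ugraph (face b G)) = head (ugraph G)" "typing (face b G) = typing G"
  by (auto simp: face_def)

section \<open>Morphisms preserve the kinds of vertices and arcs\<close>

lemma tmorphism_bang_verts:
  "tmorphism A f B \<Longrightarrow> v \<in> verts (ugraph A) \<Longrightarrow> vmap f v \<in> bang_verts B \<longleftrightarrow> v \<in> bang_verts A"
  by (auto simp: tmorphism_iff bang_verts_def)

lemma tmorphism_wire_verts:
  "tmorphism A f B \<Longrightarrow> v \<in> verts (ugraph A) \<Longrightarrow> vmap f v \<in> wire_verts B \<longleftrightarrow> v \<in> wire_verts A"
  by (auto simp: tmorphism_iff wire_verts_def)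

lemma tmorphism_plain_arcs:
  "tmorphism A f B \<Longrightarrow> wf_digraph (ugraph A) \<Longrightarrow> e \<in> arcs (ugraph A) \<Longrightarrow>
    emap f e \<in> plain_arcs B \<longleftrightarrow> e \<in> plain_arcs A"
  by (auto simp: plain_arcs_def tmorphism_iff bang_verts_def wf_digraph_def)

lemma tmorphism_end_of:
  "tmorphism A f B \<Longrightarrow> e \<in> arcs (ugraph A) \<Longrightarrow>
    end_of b (ugraph B) (emap f e) = vmap f (end_of b (ugraph A) e)"
  by (auto simp: end_of_def tmorphism_iff)


text \<open>Up to isomorphism this is the inclusion of \<open>Bound_bang L\<close> into
  \<open>L\<close>. Bijections onto vertex and arc sets record it without naming an inverse.\<close>

definition boundary_emb ::
  "('vi, 'vl, 'ei, 'el) gmap \<Rightarrow> ('vi, 'ei, 'o, 'm) tgraph \<Rightarrow> ('vl, 'el, 'o, 'm) tgraph \<Rightarrow> bool" where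
  "boundary_emb i I L \<longleftrightarrow> tmorphism I i L \<and>
     bij_betw (vmap i) (verts (ugraph I)) (bound_verts L) \<and>
     bij_betw (emap i) (arcs (ugraph I)) (bang_arcs L (bound_verts L))"

section \<open>Rewrite rules in terms of boundary embeddings\<close>

text \<open>The two faces together cover all vertices and arcs of \<open>Bound_bang L\<close>, so
  the two equations make \<open>i\<close> a left inverse of the isomorphism \<phi> on the whole
  boundary. Hence \<open>i\<close> coincides with the inverse \<psi> of \<phi>, which is
  bijective.\<close>

lemma boundary_emb_of_tiso:
  assumes L: "typed_graph (bang_typegraph T) L" and i: "tmorphism I i L"
    and iso: "tiso (Bound_bang L) \<phi> I"
    and eq: "gmap_eq (ugraph (In_bang L)) (i \<circ>\<^sub>g (\<phi> \<circ>\<^sub>g gmap_id)) gmap_id"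
      "gmap_eq (ugraph (Out_bang L)) (i \<circ>\<^sub>g (\<phi> \<circ>\<^sub>g gmap_id)) gmap_id"
  shows "boundary_emb i I L"
    and "\<And>x. x \<in> bound_verts L \<Longrightarrow> vmap i (vmap \<phi> x) = x"
    and "\<And>z. z \<in> verts (ugraph I) \<Longrightarrow> vmap \<phi> (vmap i z) = z"
proof -
  note simps = bang_face_simps[OF L] arcs_face[OF L]
  obtain \<psi> where psi: "tmorphism I \<psi> (Bound_bang L)"
      "gmap_eq (ugraph I) (\<phi> \<circ>\<^sub>g \<psi>) gmap_id"
    and phi: "tmorphism (Bound_bang L) \<phi> I"
    using iso by (auto simp: tiso_def)
  have v: "vmap i (vmap \<phi> x) = x" if "x \<in> bound_verts L" for x
    using that eq by (auto simp: simps gmap_eq_def gmap_comp_def gmap_id_def bound_verts_def)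
  have e: "emap i (emap \<phi> x) = x" if "x \<in> bang_arcs L (bound_verts L)" for x
    using that eq
    by (auto simp: simps gmap_eq_def gmap_comp_def gmap_id_def bound_verts_def bang_arcs_def)
  have psi_v: "vmap \<psi> z \<in> bound_verts L" "vmap \<phi> (vmap \<psi> z) = z" if "z \<in> verts (ugraph I)" for z
    using that psi by (auto simp: simps gmap_eq_def gmap_comp_def gmap_id_def tmorphism_iff)
  have psi_e: "emap \<psi> z \<in> bang_arcs L (bound_verts L)" "emap \<phi> (emap \<psi> z) = z"
    if "z \<in> arcs (ugraph I)" for z
    using that psi by (auto simp: simps gmap_eq_def gmap_comp_def gmap_id_def tmorphism_iff)
  have iv: "vmap i z = vmap \<psi> z" if "z \<in> verts (ugraph I)" for z
    using v[OF psi_v(1)[OF that]] psi_v(2)[OF that] by simp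
  have ie: "emap i z = emap \<psi> z" if "z \<in> arcs (ugraph I)" for z
    using e[OF psi_e(1)[OF that]] psi_e(2)[OF that] by simp
  have "bij_betw (vmap i) (verts (ugraph I)) (bound_verts L)"
    by (rule bij_betw_byWitness[where f' = "vmap \<phi>"])
      (use v psi_v iv phi in \<open>auto simp: tmorphism_iff simps\<close>)
  moreover have "bij_betw (emap i) (arcs (ugraph I)) (bang_arcs L (bound_verts L))"
    by (rule bij_betw_byWitness[where f' = "emap \<phi>"])
      (use e psi_e ie phi in \<open>auto simp: tmorphism_iff simps\<close>)
  ultimately show "boundary_emb i I L" using i by (simp add: boundary_emb_def)
  show "\<And>x. x \<in> bound_verts L \<Longrightarrow> vmap i (vmap \<phi> x) = x" by (rule v)
  show "\<And>z. z \<in> verts (ugraph I) \<Longrightarrow> vmap \<phi> (vmap i z) = z" using psi_v iv by simp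
qed

text \<open>The commutation conditions force the isomorphism of faces to be \<open>i2\<close> after
  the inverse of \<open>i1\<close>. As it maps the inputs of \<open>L\<close> to those of
  \<open>R\<close>, and its inverse maps them back, inputs correspond through \<open>I\<close>;
  likewise outputs.\<close>

lemma rewrite_rule_boundary:
  assumes rr: "rewrite_rule T L i1 I i2 R"
  shows "boundary_emb i1 I L" "boundary_emb i2 I R"
    and "\<And>z b. z \<in> verts (ugraph I) \<Longrightarrow>
           vmap i1 z \<in> free_wires b L \<longleftrightarrow> vmap i2 z \<in> free_wires b R"
proof -
  obtain \<phi>I \<phi>O \<phi>L \<phi>R where
    iso: "tiso (In_bang L) \<phi>I (In_bang R)" "tiso (Out_bang L) \<phi>O (Out_bang R)"
      "tiso (Bound_bang L) \<phi>L I" "tiso (Bound_bang R) \<phi>R I"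
    and eqL: "gmap_eq (ugraph (In_bang L)) (i1 \<circ>\<^sub>g (\<phi>L \<circ>\<^sub>g gmap_id)) gmap_id"
      "gmap_eq (ugraph (Out_bang L)) (i1 \<circ>\<^sub>g (\<phi>L \<circ>\<^sub>g gmap_id)) gmap_id"
    and eqR: "gmap_eq (ugraph (In_bang R)) (i2 \<circ>\<^sub>g (\<phi>R \<circ>\<^sub>g gmap_id)) gmap_id"
      "gmap_eq (ugraph (Out_bang R)) (i2 \<circ>\<^sub>g (\<phi>R \<circ>\<^sub>g gmap_id)) gmap_id"
    and comm: "gmap_eq (ugraph (In_bang L)) (\<phi>R \<circ>\<^sub>g gmap_id \<circ>\<^sub>g \<phi>I) (\<phi>L \<circ>\<^sub>g gmap_id)"
      "gmap_eq (ugraph (Out_bang L)) (\<phi>R \<circ>\<^sub>g gmap_id \<circ>\<^sub>g \<phi>O) (\<phi>L \<circ>\<^sub>g gmap_id)"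
    using rr unfolding rewrite_rule_def Let_def by blast
  have typed: "typed_graph (bang_typegraph T) L" "typed_graph (bang_typegraph T) R"
    and i: "tmorphism I i1 L" "tmorphism I i2 R"
    using rr by (auto simp: rewrite_rule_def bang_graph_def)
  note bL = boundary_emb_of_tiso[OF typed(1) i(1) iso(3) eqL]
  note bR = boundary_emb_of_tiso[OF typed(2) i(2) iso(4) eqR]
  show "boundary_emb i1 I L" "boundary_emb i2 I R" by (fact bL(1), fact bR(1))
  fix z b assume z: "z \<in> verts (ugraph I)"
  define \<phi> where "\<phi> = (if b then \<phi>I else \<phi>O)"
  have phi: "tiso (face b L) \<phi> (face b R)"
    and eq: "gmap_eq (ugraph (face b L)) (\<phi>R \<circ>\<^sub>g gmap_id \<circ>\<^sub>g \<phi>) (\<phi>L \<circ>\<^sub>g gmap_id)"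
    using iso(1,2) comm bang_face_simps[OF typed(1)] bang_face_simps[OF typed(2)]
    by (auto simp: \<phi>_def)
  obtain \<psi> where psi: "tmorphism (face b R) \<psi> (face b L)"
      "gmap_eq (ugraph (face b R)) (\<phi> \<circ>\<^sub>g \<psi>) gmap_id"
    and phi_m: "tmorphism (face b L) \<phi> (face b R)"
    using phi unfolding tiso_def by blast
  have phi_R: "vmap \<phi> x \<in> verts (ugraph (face b R))" if "x \<in> verts (ugraph (face b L))" for x
    using phi_m that unfolding tmorphism_iff by blast
  have psi_L: "vmap \<psi> y \<in> verts (ugraph (face b L))" if "y \<in> verts (ugraph (face b R))" for y
    using psi(1) that unfolding tmorphism_iff by blast
  have phi_psi: "vmap \<phi> (vmap \<psi> y) = y" if "y \<in> verts (ugraph (face b R))" for y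
    using psi(2) that by (simp add: gmap_eq_def gmap_comp_def gmap_id_def)
  have eq': "vmap \<phi>R (vmap \<phi> x) = vmap \<phi>L x" if "x \<in> verts (ugraph (face b L))" for x
    using eq that by (auto simp: gmap_eq_def gmap_comp_def gmap_id_def)
  have sub: "verts (ugraph (face b L)) \<subseteq> bound_verts L" "verts (ugraph (face b R)) \<subseteq> bound_verts R"
    using free_wires_subset[of b L] free_wires_subset[of b R] by (auto simp: bound_verts_def)
  \<comment> \<open>A vertex of a face is a !-vertex or a free wire. Both legs preserve types, so a
    wire-vertex on one side excludes the first case on the other.\<close>
  have wires: "vmap i1 z \<in> wire_verts L \<longleftrightarrow> vmap i2 z \<in> wire_verts R"
    using tmorphism_wire_verts z i by metis
  show "vmap i1 z \<in> free_wires b L \<longleftrightarrow> vmap i2 z \<in> free_wires b R"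
  proof
    assume f: "vmap i1 z \<in> free_wires b L"
    then have x: "vmap i1 z \<in> verts (ugraph (face b L))" by simp
    have "vmap \<phi>R (vmap \<phi> (vmap i1 z)) = z" using eq'[OF x] bL(3)[OF z] by simp
    then have "vmap i2 z = vmap \<phi> (vmap i1 z)" using bR(2) phi_R[OF x] sub(2) by force
    with phi_R[OF x] have "vmap i2 z \<in> verts (ugraph (face b R))" by simp
    with wires f show "vmap i2 z \<in> free_wires b R"
      by (auto dest: free_wires_wire wire_not_bang)
  next
    assume f: "vmap i2 z \<in> free_wires b R"
    then have y: "vmap i2 z \<in> verts (ugraph (face b R))" by simp
    let ?x = "vmap \<psi> (vmap i2 z)"
    have "vmap \<phi>L ?x = z" using eq'[OF psi_L[OF y]] phi_psi[OF y] bR(3)[OF z] by simp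
    then have "vmap i1 z = ?x" using bL(2) psi_L[OF y] sub(1) by force
    with psi_L[OF y] have "vmap i1 z \<in> verts (ugraph (face b L))" by simp
    with wires f show "vmap i1 z \<in> free_wires b L"
      by (auto dest: free_wires_wire wire_not_bang)
  qed
qed

section \<open>From boundary embeddings back to the isomorphisms of a rewrite rule\<close>

definition gmap_inv :: "('v, 'e, 'o, 'm) tgraph \<Rightarrow> ('v, 'w, 'e, 'f) gmap \<Rightarrow> ('w, 'v, 'f, 'e) gmap" where
  "gmap_inv A f = \<lparr>vmap = inv_into (verts (ugraph A)) (vmap f), emap = inv_into (arcs (ugraph A)) (emap f)\<rparr>"

lemma boundary_emb_inv:
  assumes "boundary_emb i I L"
  shows "x \<in> bound_verts L \<Longrightarrow> vmap (gmap_inv I i) x \<in> verts (ugraph I)"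
    and "x \<in> bound_verts L \<Longrightarrow> vmap i (vmap (gmap_inv I i) x) = x"
    and "z \<in> verts (ugraph I) \<Longrightarrow> vmap (gmap_inv I i) (vmap i z) = z"
    and "e \<in> bang_arcs L (bound_verts L) \<Longrightarrow> emap (gmap_inv I i) e \<in> arcs (ugraph I)"
    and "e \<in> bang_arcs L (bound_verts L) \<Longrightarrow> emap i (emap (gmap_inv I i) e) = e"
    and "a \<in> arcs (ugraph I) \<Longrightarrow> emap (gmap_inv I i) (emap i a) = a"
    and "z \<in> verts (ugraph I) \<Longrightarrow> vmap i z \<in> bound_verts L"
    and "a \<in> arcs (ugraph I) \<Longrightarrow> emap i a \<in> bang_arcs L (bound_verts L)"
  using assms unfolding boundary_emb_def gmap_inv_def bij_betw_def
  by (auto simp: inv_into_into f_inv_into_f)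

text \<open>Every boundary arc is \<open>i\<close> of its preimage, and \<open>i\<close> respects
  ends and types; cancelling the injective \<open>i\<close> shows that the inverse respects them as
  well.\<close>

lemma boundary_emb_tiso:
  assumes L: "typed_graph (bang_typegraph T) L" and I: "wf_digraph (ugraph I)"
    and emb: "boundary_emb i I L"
  shows "tiso (Bound_bang L) (gmap_inv I i) I"
proof -
  note inv = boundary_emb_inv[OF emb]
  have i: "tmorphism I i L" using emb by (simp add: boundary_emb_def)
  have ends: "tail (ugraph I) (emap (gmap_inv I i) e) = vmap (gmap_inv I i) (tail (ugraph L) e)"
    "head (ugraph I) (emap (gmap_inv I i) e) = vmap (gmap_inv I i) (head (ugraph L) e)"
    "emap (typing I) (emap (gmap_inv I i) e) = emap (typing L) e"
    if e: "e \<in> bang_arcs L (bound_verts L)" for e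
  proof -
    let ?a = "emap (gmap_inv I i) e"
    have a: "?a \<in> arcs (ugraph I)" "emap i ?a = e" using inv(4,5)[OF e] by auto
    have "tail (ugraph L) e = vmap i (tail (ugraph I) ?a)"
      "head (ugraph L) e = vmap i (head (ugraph I) ?a)" "emap (typing L) e = emap (typing I) ?a"
      using i a unfolding tmorphism_iff by metis+
    then show "tail (ugraph I) ?a = vmap (gmap_inv I i) (tail (ugraph L) e)"
      "head (ugraph I) ?a = vmap (gmap_inv I i) (head (ugraph L) e)"
      "emap (typing I) ?a = emap (typing L) e"
      using inv(3) a I by (auto simp: wf_digraph_def)
  qed
  have types: "vmap (typing I) (vmap (gmap_inv I i) x) = vmap (typing L) x" if "x \<in> bound_verts L" for x
    using i inv(1,2)[OF that] unfolding tmorphism_iff by metis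
  have "tmorphism (Bound_bang L) (gmap_inv I i) I"
    unfolding bang_face_simps[OF L] tmorphism_iff using inv ends types by simp
  moreover have "tmorphism I i (Bound_bang L)"
    using i inv unfolding bang_face_simps[OF L] tmorphism_iff by simp
  ultimately show ?thesis
    unfolding tiso_def bang_face_simps[OF L]
    using inv by (auto simp: gmap_eq_def gmap_comp_def gmap_id_def intro!: exI[of _ i])
qed

lemma face_subset_bound:
  "verts (ugraph (face b L)) \<subseteq> bound_verts L"
  "bang_arcs L (bang_verts L \<union> free_wires b L) \<subseteq> bang_arcs L (bound_verts L)"
  using free_wires_subset[of b L] by (auto simp: bound_verts_def bang_arcs_def)

text \<open>The composite is already a morphism from the boundary of \<open>L\<close> to
  \<open>R\<close>. It sends !-vertices to !-vertices by typing and free wires to free wires by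
  \<open>free\<close>; since the target face is a full subgraph, arcs land in it once their ends
  do.\<close>

lemma boundary_emb_face_tmorphism:
  assumes L: "typed_graph (bang_typegraph T) L"
    and I: "wf_digraph (ugraph I)"
    and emb: "boundary_emb i1 I L" "boundary_emb i2 I R"
    and free: "\<And>z. z \<in> verts (ugraph I) \<Longrightarrow>
           vmap i1 z \<in> free_wires b L \<longleftrightarrow> vmap i2 z \<in> free_wires b R"
  shows "tmorphism (face b L) (i2 \<circ>\<^sub>g gmap_inv I i1) (face b R)"
proof -
  let ?f = "gmap_inv I i1"
  note inv = boundary_emb_inv[OF emb(1)]
  have f: "tmorphism (Bound_bang L) ?f I"
    using boundary_emb_tiso[OF L I emb(1)] by (simp add: tiso_def)
  have i: "tmorphism I i1 L" "tmorphism I i2 R" using emb by (auto simp: boundary_emb_def)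
  have v: "vmap i2 (vmap ?f x) \<in> bang_verts R \<union> free_wires b R"
    if "x \<in> bang_verts L \<union> free_wires b L" for x
  proof -
    have x: "x \<in> bound_verts L" using that face_subset_bound(1)[of b L] by auto
    then show ?thesis
      using that inv(1,2)[OF x] free[OF inv(1)[OF x]] tmorphism_bang_verts[OF i(1) inv(1)[OF x]]
        tmorphism_bang_verts[OF i(2) inv(1)[OF x]] by auto
  qed
  have "tmorphism (Bound_bang L) (i2 \<circ>\<^sub>g ?f) R"
  proof (rule tmorphism_comp[OF f i(2)])
    show "wf_digraph (ugraph (Bound_bang L))"
      unfolding bang_face_simps[OF L] by unfold_locales (auto simp: bang_arcs_def bound_verts_def)
  qed
  note m = this[unfolded bang_face_simps[OF L] tmorphism_iff, simplified]
  show ?thesis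
    unfolding tmorphism_iff arcs_face[OF L]
  proof (intro conjI ballI)
    fix x assume "x \<in> verts (ugraph (face b L))"
    then have x: "x \<in> bang_verts L \<union> free_wires b L" "x \<in> bound_verts L"
      using face_subset_bound(1)[of b L] by auto
    show "vmap (i2 \<circ>\<^sub>g ?f) x \<in> verts (ugraph (face b R))"
      using v[OF x(1)] by (simp add: gmap_comp_def)
    show "vmap (typing (face b R)) (vmap (i2 \<circ>\<^sub>g ?f) x) = vmap (typing (face b L)) x"
      using m x by simp
  next
    fix e assume e: "e \<in> bang_arcs L (bang_verts L \<union> free_wires b L)"
    then have e': "e \<in> bang_arcs L (bound_verts L)" using face_subset_bound(2)[of L b] by auto
    then have *: "emap (i2 \<circ>\<^sub>g ?f) e \<in> arcs (ugraph R)"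
      "tail (ugraph R) (emap (i2 \<circ>\<^sub>g ?f) e) = vmap (i2 \<circ>\<^sub>g ?f) (tail (ugraph L) e)"
      "head (ugraph R) (emap (i2 \<circ>\<^sub>g ?f) e) = vmap (i2 \<circ>\<^sub>g ?f) (head (ugraph L) e)"
      "emap (typing R) (emap (i2 \<circ>\<^sub>g ?f) e) = emap (typing L) e"
      using m by auto
    show "tail (ugraph (face b R)) (emap (i2 \<circ>\<^sub>g ?f) e) = vmap (i2 \<circ>\<^sub>g ?f) (tail (ugraph (face b L)) e)"
      "head (ugraph (face b R)) (emap (i2 \<circ>\<^sub>g ?f) e) = vmap (i2 \<circ>\<^sub>g ?f) (head (ugraph (face b L)) e)"
      "emap (typing (face b R)) (emap (i2 \<circ>\<^sub>g ?f) e) = emap (typing (face b L)) e"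
      using * by auto
    have "tail (ugraph L) e \<in> bang_verts L \<union> free_wires b L"
      "head (ugraph L) e \<in> bang_verts L \<union> free_wires b L"
      using e by (auto simp: bang_arcs_def)
    then show "emap (i2 \<circ>\<^sub>g ?f) e \<in> arcs (ugraph (face b R))"
      using * v unfolding face_def by (simp add: gmap_comp_def)
  qed
qed

lemma boundary_emb_face_tiso:
  assumes L: "typed_graph (bang_typegraph T) L" and R: "typed_graph (bang_typegraph T) R"
    and I: "wf_digraph (ugraph I)"
    and emb: "boundary_emb i1 I L" "boundary_emb i2 I R"
    and free: "\<And>z. z \<in> verts (ugraph I) \<Longrightarrow>
           vmap i1 z \<in> free_wires b L \<longleftrightarrow> vmap i2 z \<in> free_wires b R"
  shows "tiso (face b L) (i2 \<circ>\<^sub>g gmap_inv I i1) (face b R)"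
proof -
  have "tmorphism (face b L) (i2 \<circ>\<^sub>g gmap_inv I i1) (face b R)"
    by (rule boundary_emb_face_tmorphism[OF L I emb free])
  moreover have "tmorphism (face b R) (i1 \<circ>\<^sub>g gmap_inv I i2) (face b L)"
    by (rule boundary_emb_face_tmorphism[OF R I emb(2,1)]) (simp add: free)
  moreover have "gmap_eq (ugraph (face b L)) (i1 \<circ>\<^sub>g gmap_inv I i2 \<circ>\<^sub>g (i2 \<circ>\<^sub>g gmap_inv I i1)) gmap_id"
    unfolding gmap_eq_def arcs_face[OF L]
    using boundary_emb_inv[OF emb(1)] boundary_emb_inv[OF emb(2)] face_subset_bound[where b = b and L = L]
    by (auto simp: gmap_comp_def gmap_id_def subset_iff)
  moreover have "gmap_eq (ugraph (face b R)) (i2 \<circ>\<^sub>g gmap_inv I i1 \<circ>\<^sub>g (i1 \<circ>\<^sub>g gmap_inv I i2)) gmap_id"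
    unfolding gmap_eq_def arcs_face[OF R]
    using boundary_emb_inv[OF emb(1)] boundary_emb_inv[OF emb(2)] face_subset_bound[where b = b and L = R]
    by (auto simp: gmap_comp_def gmap_id_def subset_iff)
  ultimately show ?thesis unfolding tiso_def by blast
qed

text \<open>Converse of \<open>rewrite_rule_boundary\<close>. The inverses of the two embeddings
  serve as \<open>\<phi>\<^sub>L\<close> and \<open>\<phi>\<^sub>R\<close>, and the single map
  \<open>i2 \<circ>\<^sub>g gmap_inv I i1\<close> serves as both \<open>\<phi>\<^sub>I\<close> and
  \<open>\<phi>\<^sub>O\<close>.\<close>

lemma rewrite_rule_of_boundary:
  assumes bang: "bang_graph T L" "bang_graph T I" "bang_graph T R"
    and iso: "\<forall>w\<in>wire_verts (U_of L). \<not> isolated (ugraph (U_of L)) w"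
      "\<forall>w\<in>wire_verts (U_of R). \<not> isolated (ugraph (U_of R)) w"
    and emb: "boundary_emb i1 I L" "boundary_emb i2 I R"
    and free: "\<And>z b. z \<in> verts (ugraph I) \<Longrightarrow>
           vmap i1 z \<in> free_wires b L \<longleftrightarrow> vmap i2 z \<in> free_wires b R"
  shows "rewrite_rule T L i1 I i2 R"
proof -
  have typed: "typed_graph (bang_typegraph T) L" "typed_graph (bang_typegraph T) R"
    and I: "wf_digraph (ugraph I)"
    using bang by (auto simp: bang_graph_def intro: typed_graph_wf)
  let ?\<phi> = "i2 \<circ>\<^sub>g gmap_inv I i1"
  note inv = boundary_emb_inv[OF emb(1)] boundary_emb_inv[OF emb(2)]
  note simps = bang_face_simps(1,2)[OF typed(1)] bang_face_simps(1,2)[OF typed(2)]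
  have tiso: "tiso (face b L) ?\<phi> (face b R)" for b
    by (rule boundary_emb_face_tiso[OF typed I emb free])
  have eq: "gmap_eq (ugraph (face b L)) (i1 \<circ>\<^sub>g (gmap_inv I i1 \<circ>\<^sub>g gmap_id)) gmap_id"
    "gmap_eq (ugraph (face b R)) (i2 \<circ>\<^sub>g (gmap_inv I i2 \<circ>\<^sub>g gmap_id)) gmap_id"
    "gmap_eq (ugraph (face b L)) (gmap_inv I i2 \<circ>\<^sub>g gmap_id \<circ>\<^sub>g ?\<phi>) (gmap_inv I i1 \<circ>\<^sub>g gmap_id)" for b
    unfolding gmap_eq_def arcs_face[OF typed(1)] arcs_face[OF typed(2)]
    using inv face_subset_bound[where b = b and L = L] face_subset_bound[where b = b and L = R]
    by (auto simp: gmap_comp_def gmap_id_def subset_iff)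
  have "tmorphism I i1 L" "tmorphism I i2 R" using emb by (auto simp: boundary_emb_def)
  then show ?thesis
    unfolding rewrite_rule_def Let_def simps
    using bang iso tiso eq boundary_emb_tiso[OF typed(1) I emb(1)] boundary_emb_tiso[OF typed(2) I emb(2)]
    by blast
qed

section \<open>Transport of boundaries along the pushouts\<close>

lemma boundary_emb_inj:
  assumes "boundary_emb i I L"
  shows "inj_on (vmap i) (verts (ugraph I))" "inj_on (emap i) (arcs (ugraph I))"
  using assms by (auto simp: boundary_emb_def bij_betw_def)

text \<open>Injectivity of \<open>g\<close> comes from that of \<open>i\<close>. The point is
  surjectivity onto the boundary of \<open>G\<close>: the part of \<open>L\<close> outside the image
  of \<open>I\<close> contributes neither vertices nor arcs to it.\<close>

lemma boundary_emb_pushout: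
  assumes po: "is_pushout T I i L d D m g G" and emb: "boundary_emb i I L"
  shows "boundary_emb g (bang_sub D {y \<in> verts (ugraph D). vmap g y \<in> bound_verts G}) G"
proof -
  let ?S = "{y \<in> verts (ugraph D). vmap g y \<in> bound_verts G}"
  have typed: "typed_graph (bang_typegraph T) I" "typed_graph (bang_typegraph T) L"
      "typed_graph (bang_typegraph T) D" "typed_graph (bang_typegraph T) G"
    and mor: "tmorphism I i L" "tmorphism I d D" "tmorphism L m G" "tmorphism D g G"
    and comm: "gmap_eq (ugraph I) (m \<circ>\<^sub>g i) (g \<circ>\<^sub>g d)"
    using po by (auto simp: is_pushout_def)
  note inj = boundary_emb_inj[OF emb]
  note inv = boundary_emb_inv[OF emb]
  note surj = pushout_jointly_surj[OF po]
  note mono = pushout_mono[OF po inj]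
  have comm_v: "vmap m (vmap i z) = vmap g (vmap d z)" if "z \<in> verts (ugraph I)" for z
    using comm that by (simp add: gmap_eq_def gmap_comp_def)
  have comm_e: "emap m (emap i z) = emap g (emap d z)" if "z \<in> arcs (ugraph I)" for z
    using comm that by (simp add: gmap_eq_def gmap_comp_def)
  have verts_L: "vmap m x \<in> vmap g ` verts (ugraph D)" if "x \<in> bound_verts L" for x
    using comm_v[OF inv(1)[OF that]] inv(1,2)[OF that] mor(2) by (simp add: tmorphism_iff)
  have bound: "w \<in> vmap g ` verts (ugraph D)" if w: "w \<in> bound_verts G" for w
  proof (rule ccontr)
    assume n: "w \<notin> vmap g ` verts (ugraph D)"
    have "w \<in> verts (ugraph G)"
      using w by (auto simp: bound_verts_def free_wires_def wire_verts_def bang_verts_def)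
    then obtain x where x: "x \<in> verts (ugraph L)" "w = vmap m x" using n surj(1) by auto
    then have nx: "x \<notin> bound_verts L" using n verts_L by auto
    then obtain b where b: "w \<in> free_wires b G"
      using w x tmorphism_bang_verts[OF mor(3) x(1)] by (auto simp: bound_verts_def)
    then have "x \<in> wire_verts L"
      using tmorphism_wire_verts[OF mor(3) x(1)] x(2) free_wires_wire[OF b] by simp
    \<comment> \<open>As \<open>x\<close> is interior, some plain arc of \<open>L\<close> has
      \<open>x\<close> as its end on side \<open>b\<close>; its image under \<open>m\<close>
      contradicts that \<open>w\<close> is free in \<open>G\<close>.\<close>
    moreover have "x \<notin> free_wires b L" using nx free_wires_subset[of b L] by auto
    ultimately obtain e where e: "e \<in> plain_arcs L" "end_of b (ugraph L) e = x"
      by (auto simp: free_wires_def)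
    then have "e \<in> arcs (ugraph L)" by (simp add: plain_arcs_def)
    then have "emap m e \<in> plain_arcs G" "end_of b (ugraph G) (emap m e) = w"
      using e x tmorphism_plain_arcs[OF mor(3) typed_graph_wf[OF typed(2)]]
        tmorphism_end_of[OF mor(3)] by auto
    with b show False by (auto simp: free_wires_def)
  qed
  have vimg: "vmap g ` ?S = bound_verts G" using bound by auto
  have "emap g ` bang_arcs D ?S = bang_arcs G (bound_verts G)"
  proof (rule equalityI; rule subsetI)
    fix a assume "a \<in> emap g ` bang_arcs D ?S"
    then obtain e where e: "e \<in> bang_arcs D ?S" "a = emap g e" by auto
    then have "tail (ugraph D) e \<in> verts (ugraph D)" using typed(3)
      by (auto simp: bang_arcs_def typed_graph_iff)
    then show "a \<in> bang_arcs G (bound_verts G)"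
      using e mor(4) tmorphism_bang_verts[OF mor(4)] by (auto simp: bang_arcs_def tmorphism_iff)
  next
    fix a assume a: "a \<in> bang_arcs G (bound_verts G)"
    then have a': "a \<in> arcs (ugraph G)" "tail (ugraph G) a \<in> bang_verts G"
      "head (ugraph G) a \<in> bound_verts G" by (auto simp: bang_arcs_def)
    have "a \<in> emap g ` arcs (ugraph D)"
    proof (rule ccontr)
      assume n: "a \<notin> emap g ` arcs (ugraph D)"
      then obtain e where e: "e \<in> arcs (ugraph L)" "a = emap m e" using a'(1) surj(2) by auto
      have ends: "tail (ugraph L) e \<in> verts (ugraph L)" "head (ugraph L) e \<in> verts (ugraph L)"
        using e typed(2) by (auto simp: typed_graph_iff)
      have me: "tail (ugraph G) a = vmap m (tail (ugraph L) e)"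
        "head (ugraph G) a = vmap m (head (ugraph L) e)"
        using e mor(3) by (auto simp: tmorphism_iff)
      obtain y where y: "y \<in> verts (ugraph D)" "head (ugraph G) a = vmap g y"
        using bound[OF a'(3)] by auto
      \<comment> \<open>The head comes from both \<open>L\<close> and \<open>D\<close>, hence from
        \<open>I\<close>. So \<open>e\<close> is a boundary arc of \<open>L\<close>, thus comes from
        \<open>I\<close> as well, and its image in \<open>G\<close> comes from
        \<open>D\<close>.\<close>
      obtain z where z: "z \<in> verts (ugraph I)" "head (ugraph L) e = vmap i z"
        using mono(3)[OF ends(2) y(1)] y(2) me(2) by auto
      have "e \<in> bang_arcs L (bound_verts L)"
        using e a'(2) me(1) tmorphism_bang_verts[OF mor(3) ends(1)] inv(7)[OF z(1)] z(2)
        by (auto simp: bang_arcs_def)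
      from comm_e[OF inv(4)[OF this]] inv(4,5)[OF this] e(2) n mor(2) show False
        by (auto simp: tmorphism_iff)
    qed
    then obtain e where e: "e \<in> arcs (ugraph D)" "a = emap g e" by auto
    then have ends: "tail (ugraph D) e \<in> verts (ugraph D)" "head (ugraph D) e \<in> verts (ugraph D)"
      using typed(3) by (auto simp: typed_graph_iff)
    have "tail (ugraph G) a = vmap g (tail (ugraph D) e)"
      "head (ugraph G) a = vmap g (head (ugraph D) e)"
      using e mor(4) by (auto simp: tmorphism_iff)
    then have "e \<in> bang_arcs D ?S"
      using a' e ends tmorphism_bang_verts[OF mor(4) ends(1)] by (auto simp: bang_arcs_def)
    with e show "a \<in> emap g ` bang_arcs D ?S" by auto
  qed
  moreover have "inj_on (emap g) (bang_arcs D ?S)"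
    using mono(2) by (rule inj_on_subset) (auto simp: bang_arcs_def)
  moreover have "inj_on (vmap g) ?S"
    using mono(1) by (rule inj_on_subset) auto
  moreover have "tmorphism (bang_sub D ?S) g G"
    using mor(4) by (auto simp: tmorphism_iff bang_arcs_def)
  ultimately show ?thesis
    using vimg unfolding boundary_emb_def bij_betw_def by simp
qed

section \<open>Passing from \<open>G\<close> to \<open>H\<close>: free wires and isolated
  wire-vertices\<close>

text \<open>Suppose a plain arc of \<open>H\<close> had \<open>h y\<close> as its end on side
  \<open>b\<close>. If it comes from \<open>D\<close>, it gives such an arc at \<open>g y\<close> in
  \<open>G\<close>. If it comes from \<open>R\<close>, then \<open>y\<close> comes from some
  \<open>z\<close> in \<open>I\<close>; plain arcs of \<open>L\<close> at \<open>i1 z\<close> would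
  appear in \<open>G\<close>, so \<open>i1 z\<close> is free in \<open>L\<close>, hence
  \<open>i2 z\<close> is free in \<open>R\<close>, a contradiction. The two sides enter with a
  one-way hypothesis, so exchanging them gives the converse.\<close>

lemma pushout_free_wires:
  assumes poG: "is_pushout T I i1 L d D m g G" and poH: "is_pushout T I i2 R d D r h H"
    and emb: "boundary_emb i1 I L" "boundary_emb i2 I R"
    and free: "\<And>z. z \<in> verts (ugraph I) \<Longrightarrow>
           vmap i1 z \<in> free_wires b L \<Longrightarrow> vmap i2 z \<in> free_wires b R"
    and y: "y \<in> verts (ugraph D)" "vmap g y \<in> free_wires b G"
  shows "vmap h y \<in> free_wires b H"
proof -
  have typed: "typed_graph (bang_typegraph T) L" "typed_graph (bang_typegraph T) R"
      "typed_graph (bang_typegraph T) D" "typed_graph (bang_typegraph T) I"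
    and mor: "tmorphism L m G" "tmorphism D g G" "tmorphism R r H" "tmorphism D h H"
      "tmorphism I i1 L" "tmorphism I i2 R"
    and comm: "gmap_eq (ugraph I) (m \<circ>\<^sub>g i1) (g \<circ>\<^sub>g d)"
    using poG poH by (auto simp: is_pushout_def)
  note wf = typed[THEN typed_graph_wf]
  note mono = pushout_mono[OF poH boundary_emb_inj[OF emb(2)]]
  have gy: "e \<in> plain_arcs G \<Longrightarrow> end_of b (ugraph G) e \<noteq> vmap g y" for e
    using y(2) by (auto simp: free_wires_def)
  have "y \<in> wire_verts D" using tmorphism_wire_verts[OF mor(2) y(1)] free_wires_wire[OF y(2)] by simp
  then have wire: "vmap h y \<in> wire_verts H" using tmorphism_wire_verts[OF mor(4) y(1)] by simp
  have "end_of b (ugraph H) a \<noteq> vmap h y" if a: "a \<in> plain_arcs H" for a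
  proof
    assume end_a: "end_of b (ugraph H) a = vmap h y"
    have "a \<in> arcs (ugraph H)" using a by (simp add: plain_arcs_def)
    then consider (R) e where "e \<in> arcs (ugraph R)" "a = emap r e"
      | (D) e where "e \<in> arcs (ugraph D)" "a = emap h e"
      using pushout_jointly_surj(2)[OF poH] by auto
    then show False
    proof cases
      case R
      have e: "e \<in> plain_arcs R" using R a tmorphism_plain_arcs[OF mor(3) wf(2)] by auto
      have "vmap r (end_of b (ugraph R) e) = vmap h y"
        using end_a R tmorphism_end_of[OF mor(3) R(1)] by auto
      moreover have "end_of b (ugraph R) e \<in> verts (ugraph R)"
        using R wf(2) by (auto simp: end_of_def wf_digraph_def)
      ultimately obtain z where z: "z \<in> verts (ugraph I)" "end_of b (ugraph R) e = vmap i2 z"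
          "y = vmap d z"
        using mono(3) y(1) by blast
      have "vmap m (vmap i1 z) = vmap g y"
        using comm z by (simp add: gmap_eq_def gmap_comp_def)
      moreover have z1: "vmap i1 z \<in> verts (ugraph L)" using mor(5) z by (simp add: tmorphism_iff)
      ultimately have "vmap i1 z \<in> wire_verts L"
        using tmorphism_wire_verts[OF mor(1) z1] free_wires_wire[OF y(2)] by simp
      moreover have "end_of b (ugraph L) e' \<noteq> vmap i1 z" if e': "e' \<in> plain_arcs L" for e'
      proof -
        have "e' \<in> arcs (ugraph L)" using e' by (simp add: plain_arcs_def)
        then have "emap m e' \<in> plain_arcs G"
          "end_of b (ugraph G) (emap m e') = vmap m (end_of b (ugraph L) e')"
          using e' tmorphism_plain_arcs[OF mor(1) wf(1)] tmorphism_end_of[OF mor(1)] by auto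
        then show ?thesis using gy \<open>vmap m (vmap i1 z) = vmap g y\<close> by metis
      qed
      ultimately have "vmap i1 z \<in> free_wires b L" by (simp add: free_wires_def)
      then have "vmap i2 z \<in> free_wires b R" using free z(1) by blast
      then show False using e z(2) by (auto simp: free_wires_def)
    next
      case D
      have "e \<in> plain_arcs D" using D a tmorphism_plain_arcs[OF mor(4) wf(3)] by auto
      then have "emap g e \<in> plain_arcs G" using D tmorphism_plain_arcs[OF mor(2) wf(3)] by auto
      moreover have "vmap h (end_of b (ugraph D) e) = vmap h y"
        using end_a D tmorphism_end_of[OF mor(4) D(1)] by auto
      moreover have "end_of b (ugraph D) e \<in> verts (ugraph D)"
        using D wf(3) by (auto simp: end_of_def wf_digraph_def)
      ultimately have "end_of b (ugraph D) e = y" using mono(1) y(1) by (auto dest: inj_onD)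
      then have "end_of b (ugraph G) (emap g e) = vmap g y"
        using tmorphism_end_of[OF mor(2) D(1)] by auto
      with gy[OF \<open>emap g e \<in> plain_arcs G\<close>] show False by simp
    qed
  qed
  with wire show ?thesis by (simp add: free_wires_def)
qed

lemma not_isolated_U_of_iff:
  assumes "typed_graph (bang_typegraph T) G" "w \<in> wire_verts G"
  shows "\<not> isolated (ugraph (U_of G)) w \<longleftrightarrow> (\<exists>b. \<exists>e\<in>plain_arcs G. end_of b (ugraph G) e = w)"
proof -
  have "w \<in> verts (ugraph (U_of G))" using assms(2) by (auto simp: wire_verts_def bang_verts_def)
  then show ?thesis
    unfolding isolated_def incident_arcs_def in_arcs_def out_arcs_def arcs_U_of[OF assms(1)]
    by (auto simp: end_of_def ex_bool_eq)
qed

text \<open>A wire-vertex in the image of \<open>R\<close> takes an arc from \<open>R\<close>. Any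
  other comes from a vertex of \<open>D\<close> outside the image of \<open>I\<close>; its arc in
  \<open>G\<close> cannot come from \<open>L\<close>, so it comes from \<open>D\<close> and survives
  in \<open>H\<close>.\<close>

lemma pushout_not_isolated:
  assumes poG: "is_pushout T I i1 L d D m g G" and poH: "is_pushout T I i2 R d D r h H"
    and emb: "boundary_emb i1 I L"
    and R: "\<forall>w\<in>wire_verts (U_of R). \<not> isolated (ugraph (U_of R)) w"
    and G: "\<forall>w\<in>wire_verts (U_of G). \<not> isolated (ugraph (U_of G)) w"
  shows "\<forall>w\<in>wire_verts (U_of H). \<not> isolated (ugraph (U_of H)) w"
proof
  fix w assume "w \<in> wire_verts (U_of H)"
  then have w: "w \<in> wire_verts H" by simp
  have typed: "typed_graph (bang_typegraph T) L" "typed_graph (bang_typegraph T) R"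
      "typed_graph (bang_typegraph T) D" "typed_graph (bang_typegraph T) G"
      "typed_graph (bang_typegraph T) H"
    and mor: "tmorphism L m G" "tmorphism D g G" "tmorphism R r H" "tmorphism D h H"
      "tmorphism I i2 R"
    and comm: "gmap_eq (ugraph I) (r \<circ>\<^sub>g i2) (h \<circ>\<^sub>g d)"
    using poG poH by (auto simp: is_pushout_def)
  note wf = typed[THEN typed_graph_wf]
  note mono = pushout_mono[OF poG boundary_emb_inj[OF emb]]
  have "\<exists>b. \<exists>e\<in>plain_arcs H. end_of b (ugraph H) e = w"
  proof (cases "w \<in> vmap r ` verts (ugraph R)")
    case True
    then obtain x where x: "x \<in> verts (ugraph R)" "w = vmap r x" by auto
    then have xw: "x \<in> wire_verts R" using w tmorphism_wire_verts[OF mor(3) x(1)] by simp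
    then obtain b e where e: "e \<in> plain_arcs R" "end_of b (ugraph R) e = x"
      using R not_isolated_U_of_iff[OF typed(2) xw] by auto
    then have "e \<in> arcs (ugraph R)" by (simp add: plain_arcs_def)
    then have "emap r e \<in> plain_arcs H" "end_of b (ugraph H) (emap r e) = w"
      using e x tmorphism_plain_arcs[OF mor(3) wf(2)] tmorphism_end_of[OF mor(3)] by auto
    then show ?thesis by blast
  next
    case False
    moreover have "w \<in> verts (ugraph H)" using w by (simp add: wire_verts_def)
    ultimately obtain y where y: "y \<in> verts (ugraph D)" "w = vmap h y"
      using pushout_jointly_surj(1)[OF poH] by auto
    have yI: "y \<noteq> vmap d z" if "z \<in> verts (ugraph I)" for z
    proof
      assume "y = vmap d z"
      then have "w = vmap r (vmap i2 z)" "vmap i2 z \<in> verts (ugraph R)"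
        using comm that y mor(5) by (auto simp: gmap_eq_def gmap_comp_def tmorphism_iff)
      with False show False by blast
    qed
    have gw: "vmap g y \<in> wire_verts G"
      using w y tmorphism_wire_verts[OF mor(4) y(1)] tmorphism_wire_verts[OF mor(2) y(1)] by simp
    then obtain b a where a: "a \<in> plain_arcs G" "end_of b (ugraph G) a = vmap g y"
      using G not_isolated_U_of_iff[OF typed(4) gw] by auto
    have "a \<in> arcs (ugraph G)" using a by (simp add: plain_arcs_def)
    then consider (L) e where "e \<in> arcs (ugraph L)" "a = emap m e"
      | (D) e where "e \<in> arcs (ugraph D)" "a = emap g e"
      using pushout_jointly_surj(2)[OF poG] by auto
    then show ?thesis
    proof cases
      case L
      have "vmap m (end_of b (ugraph L) e) = vmap g y"
        using a L tmorphism_end_of[OF mor(1) L(1)] by auto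
      moreover have "end_of b (ugraph L) e \<in> verts (ugraph L)"
        using L wf(1) by (auto simp: end_of_def wf_digraph_def)
      \<comment> \<open>An arc from \<open>L\<close> would meet \<open>g y\<close> in a vertex
        shared by \<open>L\<close> and \<open>D\<close>, which would put \<open>y\<close> in the
        image of \<open>I\<close>.\<close>
      ultimately show ?thesis using mono(3) y(1) yI by blast
    next
      case D
      have "vmap g (end_of b (ugraph D) e) = vmap g y"
        using a D tmorphism_end_of[OF mor(2) D(1)] by auto
      moreover have "end_of b (ugraph D) e \<in> verts (ugraph D)"
        using D wf(3) by (auto simp: end_of_def wf_digraph_def)
      ultimately have "end_of b (ugraph D) e = y" using mono(1) y(1) by (auto dest: inj_onD)
      then have "end_of b (ugraph H) (emap h e) = w"
        using tmorphism_end_of[OF mor(4) D(1)] y(2) by auto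
      moreover have "emap h e \<in> plain_arcs H"
        using D a tmorphism_plain_arcs[OF mor(2) wf(3)] tmorphism_plain_arcs[OF mor(4) wf(3)]
        by auto
      ultimately show ?thesis by blast
    qed
  qed
  then show "\<not> isolated (ugraph (U_of H)) w" using not_isolated_U_of_iff[OF typed(5) w] by simp
qed

section \<open>The interface of the derived rule\<close>

text \<open>With no node-vertices the bijection condition is vacuous, and with no arcs all degrees
  vanish. This applies to \<open>U_of\<close> of the interface and of each of its !-boxes.\<close>

lemma string_graph_discrete:
  assumes "finite (verts (ugraph K))" "arcs (ugraph K) = {}"
    and "\<And>v. v \<in> verts (ugraph K) \<Longrightarrow> v \<in> wire_verts K \<and> vmap (typing K) v \<in> verts (typegraph T)"
  shows "string_graph T K"
proof -
  have "node_verts K = {}" using assms(3) by (fastforce simp: node_verts_def wire_verts_def)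
  moreover have "typed_graph (typegraph T) K" using assms by (auto simp: typed_graph_iff)
  ultimately show ?thesis
    using assms(2) by (simp add: string_graph_def in_degree_def out_degree_def in_arcs_def out_arcs_def)
qed

lemma wf_subgraph:
  assumes "verts H \<subseteq> verts G" "arcs H \<subseteq> arcs G" "tail H = tail G" "head H = head G"
    "wf_digraph G" "\<And>e. e \<in> arcs H \<Longrightarrow> tail G e \<in> verts H \<and> head G e \<in> verts H"
  shows "subgraph H G"
  using assms by (auto simp: subgraph_def compatible_def wf_digraph_def)

lemma bang_verts_bang_sub:
  "bang_verts D \<subseteq> S \<Longrightarrow> S \<subseteq> verts (ugraph D) \<Longrightarrow> bang_verts (bang_sub D S) = bang_verts D"
  by (auto simp: bang_verts_def)

lemma dominates_iff: "a \<rightarrow>\<^bsub>G\<^esub> b \<longleftrightarrow> (\<exists>e\<in>arcs G. tail G e = a \<and> head G e = b)"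
  by (auto simp: arcs_ends_def arc_to_ends_def image_iff)

lemma tsubgraph_bang_sub:
  assumes "wf_digraph (ugraph D)" "bang_verts D \<subseteq> S" "S \<subseteq> verts (ugraph D)"
  shows "tsubgraph (bang_sub D S) D"
  unfolding tsubgraph_def using assms by (auto intro!: wf_subgraph simp: bang_arcs_def)

text \<open>All arcs kept start at !-vertices, so \<open>U_of\<close> of the result is discrete and
  openness holds trivially. Since \<open>S\<close> contains every !-vertex, the poset of !-vertices
  is unchanged, and nesting of !-boxes is inherited by intersecting with \<open>S\<close>.\<close>

lemma bang_graph_bang_sub:
  assumes D: "bang_graph T D" and S: "bang_verts D \<subseteq> S" "S \<subseteq> bang_verts D \<union> wire_verts D"
  shows "bang_graph T (bang_sub D S)"
proof -
  let ?J = "bang_sub D S"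
  have typed: "typed_graph (bang_typegraph T) D" using D by (simp add: bang_graph_def)
  note wf = typed_graph_wf[OF typed]
  have SV: "S \<subseteq> verts (ugraph D)" using S by (auto simp: bang_verts_def wire_verts_def)
  note bv = bang_verts_bang_sub[OF S(1) SV]
  have fin: "finite S" "finite (bang_arcs D S)"
    using typed SV by (auto simp: typed_graph_iff bang_arcs_def intro: finite_subset)
  have typedJ: "typed_graph (bang_typegraph T) ?J"
    using typed SV S fin unfolding typed_graph_iff by (auto simp: bang_arcs_def)
  have wires: "v \<in> wire_verts ?J \<and> vmap (typing D) v \<in> verts (typegraph T)"
    if "v \<in> S" "v \<notin> bang_verts D" for v
  proof -
    have "v \<in> wire_verts D" using that S by auto
    moreover have "vmap (typing D) v \<in> verts (bang_typegraph T)"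
      using that SV typed by (auto simp: typed_graph_iff)
    ultimately show ?thesis using that by (auto simp: wire_verts_def bang_typegraph_def)
  qed
  have arcsU: "arcs (ugraph (U_of ?J)) = {}"
    unfolding arcs_U_of[OF typedJ] by (simp add: plain_arcs_def bv bang_arcs_def)
  have strU: "string_graph T (U_of ?J)"
    by (rule string_graph_discrete) (use fin arcsU wires bv in auto)
  have beta: "ugraph (beta_of ?J) = ugraph (beta_of D)"
    using bv S by (auto simp: beta_of_def full_subgraph_def induce_subgraph_def bang_arcs_def)
  have dom: "a \<rightarrow>\<^bsub>ugraph ?J\<^esub> v \<longleftrightarrow> a \<in> bang_verts D \<and> v \<in> S \<and> a \<rightarrow>\<^bsub>ugraph D\<^esub> v" for a v
    unfolding dominates_iff by (auto simp: bang_arcs_def)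
  have "open_subgraph T (U_of (B_of ?J b)) (U_of ?J)" for b
  proof -
    let ?K = "U_of (B_of ?J b)"
    have KS: "verts (ugraph ?K) \<subseteq> S - bang_verts D"
      by (auto simp: B_of_def dom bang_verts_def)
    have Karcs: "arcs (ugraph ?K) = {}"
      by (auto simp: U_of_def B_of_def bang_arcs_def bang_verts_def dom)
    have "v \<in> wire_verts ?K \<and> vmap (typing ?K) v \<in> verts (typegraph T)"
      if v: "v \<in> verts (ugraph ?K)" for v
      using wires[of v] KS v by (auto simp: wire_verts_def B_of_def)
    then have "string_graph T ?K"
      using fin(1) KS Karcs by (intro string_graph_discrete) (auto intro: finite_subset)
    moreover have "tsubgraph ?K (U_of ?J)"
      unfolding tsubgraph_def
    proof (intro conjI wf_subgraph)
      show "wf_digraph (ugraph (U_of ?J))" using arcsU by (simp add: wf_digraph_def)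
      show "verts (ugraph ?K) \<subseteq> verts (ugraph (U_of ?J))" using KS bv by simp
    qed (use Karcs in \<open>auto simp: B_of_def\<close>)
    moreover have "\<not> v \<rightarrow>\<^bsub>ugraph (U_of ?J)\<^esub> w" for v w
      unfolding dominates_iff arcsU by simp
    moreover have "fixed_arcs (U_of ?J) = {}" by (simp add: fixed_arcs_def arcsU)
    ultimately show ?thesis using strU by (simp add: open_subgraph_def)
  qed
  moreover have "tsubgraph (B_of ?J b') (B_of ?J b)"
    if b: "b \<in> bang_verts ?J" "b' \<in> bang_verts (B_of ?J b)" for b b'
  proof -
    have "b' \<in> verts (ugraph (B_of ?J b))" using b(2) by (simp add: bang_verts_def)
    then have bJ: "b \<in> bang_verts D" "b \<rightarrow>\<^bsub>ugraph D\<^esub> b'" "b' \<in> S"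
      by (auto simp: B_of_def dom)
    have "b' \<in> bang_verts (B_of D b)" using b bJ by (auto simp: bang_verts_def B_of_def)
    then have "tsubgraph (B_of D b') (B_of D b)" using D bJ(1) by (auto simp: bang_graph_def)
    then have "{v. b' \<rightarrow>\<^bsub>ugraph D\<^esub> v} \<subseteq> {v. b \<rightarrow>\<^bsub>ugraph D\<^esub> v}"
      by (auto simp: tsubgraph_def subgraph_def B_of_def)
    then have *: "{v. b' \<rightarrow>\<^bsub>ugraph ?J\<^esub> v} \<subseteq> {v. b \<rightarrow>\<^bsub>ugraph ?J\<^esub> v}"
      using bJ by (auto simp: dom)
    show ?thesis
      unfolding tsubgraph_def
    proof (intro conjI wf_subgraph)
      show "wf_digraph (ugraph (B_of ?J b))" by (simp add: B_of_def wf_digraph_def)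
    qed (use * in \<open>auto simp: B_of_def\<close>)
  qed
  ultimately show ?thesis
    using typedJ strU D unfolding bang_graph_def beta by blast
qed

text \<open>Restriction changes the map only off \<open>J\<close>, and well-formedness keeps the
  ends of arcs of \<open>J\<close> inside \<open>J\<close>.\<close>

lemma boundary_emb_restrict:
  "wf_digraph (ugraph J) \<Longrightarrow> boundary_emb f J G \<Longrightarrow> boundary_emb (f |\<^sub>g J) J G"
  unfolding boundary_emb_def tmorphism_iff gmap_restrict_def
  by (auto simp: wf_digraph_def bij_betw_restrict_eq)

section \<open>The derived rule from \<open>G\<close> to \<open>H\<close>\<close>

theorem theorem5p14:
  fixes T :: "('o, 'm) signature"
    and L :: "('vl, 'el, 'o, 'm) tgraph"
    and I :: "('vi, 'ei, 'o, 'm) tgraph"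
    and R :: "('vr, 'er, 'o, 'm) tgraph"
    and D :: "('vd, 'ed, 'o, 'm) tgraph"
    and G :: "('vg, 'eg, 'o, 'm) tgraph"
    and H :: "('vh, 'eh, 'o, 'm) tgraph"
    and i1 :: "('vi, 'vl, 'ei, 'el) gmap"
    and i2 :: "('vi, 'vr, 'ei, 'er) gmap"
    and m :: "('vl, 'vg, 'el, 'eg) gmap"
    and d :: "('vi, 'vd, 'ei, 'ed) gmap"
    and r :: "('vr, 'vh, 'er, 'eh) gmap"
    and g :: "('vd, 'vg, 'ed, 'eg) gmap"
    and h :: "('vd, 'vh, 'ed, 'eh) gmap"
  assumes "compressed_signature T"
    and "bang_mono T I i1 L"
    and "bang_mono T I i2 R"
    and "bang_mono T L m G"
    and "bang_mono T I d D"
    and "bang_mono T R r H"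
    and "bang_mono T D g G"
    and "bang_mono T D h H"
    and "gmap_eq (ugraph I) (m \<circ>\<^sub>g i1) (g \<circ>\<^sub>g d)"
    and "gmap_eq (ugraph I) (r \<circ>\<^sub>g i2) (h \<circ>\<^sub>g d)"
    and "is_pushout T I i1 L d D m g G"
    and "is_pushout T I i2 R d D r h H"
    and "rewrite_rule T L i1 I i2 R"
    and "\<forall>v\<in>verts (ugraph (U_of G)). \<not> isolated (ugraph (U_of G)) v"
  shows "\<exists>J. tsubgraph J D \<and> rewrite_rule T G (g |\<^sub>g J) J (h |\<^sub>g J) H"
proof -
  note poG = \<open>is_pushout T I i1 L d D m g G\<close> and poH = \<open>is_pushout T I i2 R d D r h H\<close>
  note rr = \<open>rewrite_rule T L i1 I i2 R\<close>
  note emb = rewrite_rule_boundary(1,2)[OF rr] and free = rewrite_rule_boundary(3)[OF rr]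
  have bang: "bang_graph T G" "bang_graph T D" "bang_graph T H"
    and mor: "tmorphism D g G" "tmorphism D h H"
    using \<open>bang_mono T D g G\<close> \<open>bang_mono T D h H\<close> by (auto simp: bang_mono_def)
  have wf: "wf_digraph (ugraph D)" using bang(2) by (auto simp: bang_graph_def intro: typed_graph_wf)
  have freeGH: "vmap g y \<in> free_wires b G \<longleftrightarrow> vmap h y \<in> free_wires b H"
    if "y \<in> verts (ugraph D)" for y b
    using pushout_free_wires[OF poG poH emb _ that] pushout_free_wires[OF poH poG emb(2,1) _ that]
      free by blast
  define S where "S = {y \<in> verts (ugraph D). vmap g y \<in> bound_verts G}"
  \<comment> \<open>Pulling back the boundary of \<open>H\<close> gives the same vertices, since
    !-vertices are recognised by type and free wires by \<open>freeGH\<close>. Hence one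
    \<open>J\<close> fits both sides.\<close>
  have S_H: "S = {y \<in> verts (ugraph D). vmap h y \<in> bound_verts H}"
    unfolding S_def bound_verts_def
    using freeGH tmorphism_bang_verts[OF mor(1)] tmorphism_bang_verts[OF mor(2)] by auto
  \<comment> \<open>Both inclusions follow from preservation of types along \<open>g\<close>:
    !-vertices of \<open>D\<close> map to !-vertices of \<open>G\<close>, and all other boundary
    vertices of \<open>G\<close> are wires.\<close>
  have S: "bang_verts D \<subseteq> S" "S \<subseteq> bang_verts D \<union> wire_verts D"
    using tmorphism_bang_verts[OF mor(1)] tmorphism_wire_verts[OF mor(1)]
    by (auto simp: S_def bound_verts_def bang_verts_def[of D] dest!: free_wires_wire)
  define J where "J = bang_sub D S"
  have J: "bang_graph T J" unfolding J_def by (rule bang_graph_bang_sub[OF bang(2) S])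
  then have wfJ: "wf_digraph (ugraph J)" by (auto simp: bang_graph_def intro: typed_graph_wf)
  have "boundary_emb (g |\<^sub>g J) J G"
    using boundary_emb_restrict[OF wfJ] boundary_emb_pushout[OF poG emb(1)]
    by (simp add: J_def S_def)
  moreover have "boundary_emb (h |\<^sub>g J) J H"
    using boundary_emb_restrict[OF wfJ] boundary_emb_pushout[OF poH emb(2)]
    by (simp add: J_def S_H)
  moreover have G: "\<forall>w\<in>wire_verts (U_of G). \<not> isolated (ugraph (U_of G)) w"
    using assms(14) by (auto simp: wire_verts_def bang_verts_def)
  moreover have "\<forall>w\<in>wire_verts (U_of H). \<not> isolated (ugraph (U_of H)) w"
    using rr by (intro pushout_not_isolated[OF poG poH emb(1) _ G]) (simp add: rewrite_rule_def)
  moreover have "vmap (g |\<^sub>g J) z \<in> free_wires b G \<longleftrightarrow> vmap (h |\<^sub>g J) z \<in> free_wires b H"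
    if "z \<in> verts (ugraph J)" for z b
    using that freeGH by (simp add: gmap_restrict_def J_def S_def)
  ultimately have "rewrite_rule T G (g |\<^sub>g J) J (h |\<^sub>g J) H"
    by (intro rewrite_rule_of_boundary[OF bang(1) J bang(3)])
  moreover have "tsubgraph J D"
    unfolding J_def using S(1) by (intro tsubgraph_bang_sub[OF wf]) (auto simp: S_def)
  ultimately show ?thesis by blast
qed

end
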